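(* Let $\mu\in\mathbb{R}$, $\sigma>0$ be constants, $\delta,\beta,L_{max}>0$, $\lambda\le0$, $0<\alpha\le1$, and let $$b_2=-\frac{\mu-L_{max}}{\sigma^2}-\sqrt{\frac{(\mu-L_{max})^2}{\sigma^4}+\frac{2\delta}{\sigma^2}},\qquad d_2=-\frac{\mu-L_{max}}{\sigma^2}-\sqrt{\frac{(\mu-L_{max})^2}{\sigma^4}+\frac{2\beta}{\sigma^2}} .$$ If $(-b_2)\frac{L_{max}}{\delta}+\lambda d_2-1\le0$, then the threshold level is $b^*=0$ and $\hat l(t,x)=L_{max}$ (for all $t,x\ge0$) is an equilibrium control. Moreover the function $$\nu(r,t,x)=e^{-\delta(t-r)}\frac{L_{max}}{\delta}\big(1-e^{b_2x}\big)+e^{-\beta(t-r)}\lambda\big(e^{d_2x}-1\big)+\lambda(1-\alpha),\qquad r,t,x\in[0,\infty),$$ together with $\hat l\equiv L_{max}$ solves the extended HJB system given in the context, and $V(t,x)=\nu(t,t,x)$ is the equilibrium value function associated with $\hat l\equiv L_{max}$.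
   Context: Setting. $W$ is a standard Brownian motion. $\Theta$ is the set of measurable feedback functions $l:[0,\infty)^2\to[0,L_{max}]$. For $l\in\Theta$ the controlled process is $dX^l_s=(\mu-l(s,X^l_s))ds+\sigma\,dW_s$, $X^l_t=x$, with ruin time $\tau^l=\inf\{s\ge t:X^l_s\le0\}$; $\mathbb{E}_{t,x}$ is expectation given $X^l_t=x$. The reward is $$J(t,x,l)=\mathbb{E}_{t,x}\Big[\int_t^{\tau^l}e^{-\delta(s-t)}l(s,X^l_s)\,ds+\lambda\big(e^{-\beta(\tau^l-t)}-\alpha\big)\Big],\qquad e^{-\beta\cdot\infty}=0.$$ Equilibrium control: $\hat l\in\Theta$ is an equilibrium control if for every $l\in\Theta$ and every $(t,x)$ with $t,x\ge0$, $\liminf_{h\downarrow0}\frac{J(t,x,\hat l)-J(t,x,l_h)}{h}\ge0$, where $l_h(s,y)=l(s,y)$ for $t\le s<t+h$ and $l_h(s,y)=\hat l(s,y)$ for $s\ge t+h$. Its equilibrium value function is $V(t,x)=J(t,x,\hat l)$. A threshold control with level $b^*$ pays $0$ for $0\le x<b^*$ and $L_{max}$ for $x\ge b^*$; level $b^*=0$ means $\hat l\equiv L_{max}$. Extended HJB system for a function $g(r,t,x)=g^r(t,x)$: with $\mathcal{A}^l f(t,x)=\frac{\partial}{\partial t}f+(\mu-l)\frac{\partial}{\partial x}f+\frac{\sigma^2}{2}\frac{\partial^2}{\partial x^2}f$ (acting on $g^r$ with $r$ fixed; $\mathcal{A}^l g^t(t,x)$ means evaluation at $r=t$) and $H(r,s,l)=e^{-\delta(s-r)}l-\lambda\beta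 e^{-\beta(s-r)}$, (i) $\sup_{l\in[0,L_{max}]}\{\mathcal{A}^l g^t(t,x)+H(t,t,l)\}=0$ for all $t,x\ge0$, the supremum being attained at $\hat l(t,x)$; (ii) $\mathcal{A}^{\hat l}g^r(t,x)+H(r,t,\hat l(t,x))=0$ for all $r,t,x\ge0$; (iii) $\lim_{w\to\infty}\mathbb{E}_{t,x}\big[g^r(w\wedge\tau^{\hat l},X^{\hat l}_{w\wedge\tau^{\hat l}})\big]=\lambda(1-\alpha)$ for all $r,t,x\ge0$. *)

theory Defs
  imports "HOL-Probability.Probability"
begin

text \<open>Standard Brownian motion with respect to a filtration. Only times \<open>t \<ge> 0\<close> matter;
  a filtration on \<open>[0,\<infinity>)\<close> is extended to negative indices in an arbitrary monotone way.\<close>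

definition standard_brownian_motion ::
    "'a measure \<Rightarrow> (real \<Rightarrow> 'a measure) \<Rightarrow> (real \<Rightarrow> 'a \<Rightarrow> real) \<Rightarrow> bool" where
  "standard_brownian_motion M F W \<longleftrightarrow>
     prob_space M \<and>
     filtration (space M) F \<and>
     (\<forall>t\<ge>0. subalgebra M (F t)) \<and>
     (\<forall>t\<ge>0. W t \<in> borel_measurable (F t)) \<and>
     (\<forall>\<omega>\<in>space M. continuous_on {0..} (\<lambda>t. W t \<omega>)) \<and>
     (AE \<omega> in M. W 0 \<omega> = 0) \<and>
     (\<forall>s t. 0 \<le> s \<and> s < t \<longrightarrow>
        distributed M lborel (\<lambda>\<omega>. W t \<omega> - W s \<omega>) (normal_density 0 (sqrt (t - s))) \<and>
        prob_space.indep_set M (sets (F s))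
          (sets (vimage_algebra (space M) (\<lambda>\<omega>. W t \<omega> - W s \<omega>) borel)))"

text \<open>Controls are feedback functions on \<open>[0,\<infinity>)\<^sup>2\<close>, the first argument being time. Their values
  outside this quadrant are irrelevant.\<close>

type_synonym control = "real \<Rightarrow> real \<Rightarrow> real"

definition admissible_controls :: "real \<Rightarrow> control set" where
  "admissible_controls Lmax =
     {l. (\<lambda>(s, y). l s y) \<in> borel_measurable (restrict_space borel ({0..} \<times> {0..})) \<and>
         (\<forall>s\<ge>0. \<forall>y\<ge>0. 0 \<le> l s y \<and> l s y \<le> Lmax)}"

definition threshold_control :: "real \<Rightarrow> real \<Rightarrow> control" where
  "threshold_control Lmax b = (\<lambda>t x. if 0 \<le> x \<and> x < b then 0 else Lmax)"

definition ruin_time :: "real \<Rightarrow> (real \<Rightarrow> 'a \<Rightarrow> real) \<Rightarrow> 'a \<Rightarrow> ereal" where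
  "ruin_time t Y \<omega> = Inf (ereal ` {s. t \<le> s \<and> Y s \<omega> \<le> 0})"

text \<open>\<open>Y\<close> solves \<open>dY\<^sub>s = (\<mu> - l(s,Y\<^sub>s)) ds + \<sigma> dW\<^sub>s\<close>, \<open>Y\<^sub>t = x\<close>. Since \<open>\<sigma>\<close> is constant, the
  equation is stated in integrated form without a stochastic integral. As \<open>l\<close> is only given
  for states in \<open>[0,\<infinity>)\<close>, the equation is required up to the ruin time and \<open>Y\<close> is an arbitrary
  continuous adapted process thereafter.\<close>

definition controlled_process ::
    "'a measure \<Rightarrow> (real \<Rightarrow> 'a measure) \<Rightarrow> (real \<Rightarrow> 'a \<Rightarrow> real) \<Rightarrow> real \<Rightarrow> real \<Rightarrow>
     control \<Rightarrow> real \<Rightarrow> real \<Rightarrow> (real \<Rightarrow> 'a \<Rightarrow> real) \<Rightarrow> bool" where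
  "controlled_process M F W \<mu> \<sigma> l t x Y \<longleftrightarrow>
     (\<forall>s\<ge>t. Y s \<in> borel_measurable (F s)) \<and>
     (\<forall>\<omega>\<in>space M. continuous_on {t..} (\<lambda>s. Y s \<omega>)) \<and>
     (AE \<omega> in M. Y t \<omega> = x \<and>
        (\<forall>s\<ge>t. ereal s \<le> ruin_time t Y \<omega> \<longrightarrow>
           Y s \<omega> = x + (LBINT u=ereal t..ereal s. \<mu> - l u (Y u \<omega>)) + \<sigma> * (W s \<omega> - W t \<omega>)))"

text \<open>The argument \<open>X l t x\<close> below is the process controlled by \<open>l\<close> and started in \<open>x\<close> at
  time \<open>t\<close>, so that \<open>E\<^sub>t\<^sub>,\<^sub>x\<close> is the expectation under \<open>M\<close>.\<close>

definition reward ::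
    "'a measure \<Rightarrow> (control \<Rightarrow> real \<Rightarrow> real \<Rightarrow> real \<Rightarrow> 'a \<Rightarrow> real) \<Rightarrow>
     real \<Rightarrow> real \<Rightarrow> real \<Rightarrow> real \<Rightarrow> real \<Rightarrow> real \<Rightarrow> control \<Rightarrow> real" where
  "reward M X \<delta> \<beta> lam \<alpha> t x l =
     (\<integral>\<omega>. (let \<tau> = ruin_time t (X l t x) \<omega> in
            (LBINT s=ereal t..\<tau>. exp (- \<delta> * (s - t)) * l s (X l t x s \<omega>)) +
            lam * ((if \<tau> = \<infinity> then 0 else exp (- \<beta> * (real_of_ereal \<tau> - t))) - \<alpha>)) \<partial>M)"

definition perturbed_control :: "control \<Rightarrow> control \<Rightarrow> real \<Rightarrow> real \<Rightarrow> control" where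
  "perturbed_control l lhat t h = (\<lambda>s y. if t \<le> s \<and> s < t + h then l s y else lhat s y)"

definition equilibrium_control ::
    "real \<Rightarrow> (real \<Rightarrow> real \<Rightarrow> control \<Rightarrow> real) \<Rightarrow> control \<Rightarrow> bool" where
  "equilibrium_control Lmax J lhat \<longleftrightarrow>
     lhat \<in> admissible_controls Lmax \<and>
     (\<forall>l\<in>admissible_controls Lmax. \<forall>t\<ge>0. \<forall>x\<ge>0.
        0 \<le> Liminf (at_right 0)
              (\<lambda>h. ereal ((J t x lhat - J t x (perturbed_control l lhat t h)) / h)))"

definition equilibrium_value_function ::
    "real \<Rightarrow> (real \<Rightarrow> real \<Rightarrow> control \<Rightarrow> real) \<Rightarrow> control \<Rightarrow> (real \<Rightarrow> real \<Rightarrow> real) \<Rightarrow> bool" where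
  "equilibrium_value_function Lmax J lhat V \<longleftrightarrow>
     equilibrium_control Lmax J lhat \<and> (\<forall>t\<ge>0. \<forall>x\<ge>0. V t x = J t x lhat)"

text \<open>Partial derivatives on \<open>[0,\<infinity>)\<^sup>2\<close>, one-sided on the boundary.\<close>

definition partial_t :: "(real \<Rightarrow> real \<Rightarrow> real) \<Rightarrow> real \<Rightarrow> real \<Rightarrow> real" where
  "partial_t f t x = vector_derivative (\<lambda>s. f s x) (at t within {0..})"

definition partial_x :: "(real \<Rightarrow> real \<Rightarrow> real) \<Rightarrow> real \<Rightarrow> real \<Rightarrow> real" where
  "partial_x f t x = vector_derivative (\<lambda>y. f t y) (at x within {0..})"

definition C12_quadrant :: "(real \<Rightarrow> real \<Rightarrow> real) \<Rightarrow> bool" where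
  "C12_quadrant f \<longleftrightarrow>
     (\<forall>t\<ge>0. \<forall>x\<ge>0.
        (\<lambda>s. f s x) differentiable (at t within {0..}) \<and>
        (\<lambda>y. f t y) differentiable (at x within {0..}) \<and>
        (\<lambda>y. partial_x f t y) differentiable (at x within {0..})) \<and>
     (\<forall>k\<in>{f, partial_t f, partial_x f, partial_x (partial_x f)}.
        continuous_on ({0..} \<times> {0..}) (\<lambda>(t, x). k t x))"

definition generator ::
    "real \<Rightarrow> real \<Rightarrow> real \<Rightarrow> (real \<Rightarrow> real \<Rightarrow> real) \<Rightarrow> real \<Rightarrow> real \<Rightarrow> real" where
  "generator \<mu> \<sigma> u f t x =
     partial_t f t x + (\<mu> - u) * partial_x f t x + \<sigma>\<^sup>2 / 2 * partial_x (partial_x f) t x"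

definition running_reward ::
    "real \<Rightarrow> real \<Rightarrow> real \<Rightarrow> real \<Rightarrow> real \<Rightarrow> real \<Rightarrow> real" where
  "running_reward \<delta> \<beta> lam r s u = exp (- \<delta> * (s - r)) * u - lam * \<beta> * exp (- \<beta> * (s - r))"

text \<open>The supremum is that of an affine function of \<open>u\<close> on a compact interval, so it is a
  supremum of a bounded set. The derivatives in the generator act on \<open>g r\<close> with \<open>r\<close> fixed, and
  \<open>r = t\<close> is only substituted afterwards.\<close>

definition extended_HJB ::
    "'a measure \<Rightarrow> (control \<Rightarrow> real \<Rightarrow> real \<Rightarrow> real \<Rightarrow> 'a \<Rightarrow> real) \<Rightarrow>
     real \<Rightarrow> real \<Rightarrow> real \<Rightarrow> real \<Rightarrow> real \<Rightarrow> real \<Rightarrow> real \<Rightarrow>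
     (real \<Rightarrow> real \<Rightarrow> real \<Rightarrow> real) \<Rightarrow> control \<Rightarrow> bool" where
  "extended_HJB M X \<mu> \<sigma> \<delta> \<beta> Lmax lam \<alpha> g lhat \<longleftrightarrow>
     lhat \<in> admissible_controls Lmax \<and>
     (\<forall>r\<ge>0. C12_quadrant (g r)) \<and>
     (\<forall>t\<ge>0. \<forall>x\<ge>0.
        (SUP u\<in>{0..Lmax}. generator \<mu> \<sigma> u (g t) t x + running_reward \<delta> \<beta> lam t t u) = 0 \<and>
        generator \<mu> \<sigma> (lhat t x) (g t) t x + running_reward \<delta> \<beta> lam t t (lhat t x) =
          (SUP u\<in>{0..Lmax}. generator \<mu> \<sigma> u (g t) t x + running_reward \<delta> \<beta> lam t t u)) \<and>
     (\<forall>r\<ge>0. \<forall>t\<ge>0. \<forall>x\<ge>0.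
        generator \<mu> \<sigma> (lhat t x) (g r) t x + running_reward \<delta> \<beta> lam r t (lhat t x) = 0) \<and>
     (\<forall>r\<ge>0. \<forall>t\<ge>0. \<forall>x\<ge>0.
        ((\<lambda>w. \<integral>\<omega>. (let \<theta> = real_of_ereal (min (ereal w) (ruin_time t (X lhat t x) \<omega>)) in
                   g r \<theta> (X lhat t x \<theta> \<omega>)) \<partial>M) \<longlongrightarrow> lam * (1 - \<alpha>)) at_top)"

end

theory Submission
  imports Defs
begin

text \<open>
Paying at the maximal rate turns the surplus into a Brownian motion with drift \<open>m = \<mu> - L\<close>, and
\<open>b\<^sub>2\<close>, \<open>d\<^sub>2\<close> are the negative roots of \<open>\<sigma>\<^sup>2 b\<^sup>2 / 2 + m b = q\<close> for \<open>q = \<delta>\<close> and \<open>q = \<beta>\<close>. For such a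
root, \<open>exp (b Y\<^sub>s - q (s - t))\<close> is a martingale up to ruin, and optional stopping gives the Laplace
transform \<open>E exp (- q (\<tau> - t)) = exp (b x)\<close>. Since the reward of the maximal control is an affine
function of two such transforms, it equals \<open>\<nu> t t x\<close>.

For the equilibrium property no Ito formula is needed. A control that deviates from the maximal one on
\<open>[t, t + h)\<close> forgoes dividends \<open>d \<in> [0, L h]\<close>, and this amount stays in the surplus: pathwise,
\<open>Y\<^sub>s = x + m (s - t) + \<sigma> (W\<^sub>s - W\<^sub>t) + d\<close> after the deviation. The discount factor at ruin then satisfies
\<open>exp (- q (\<tau> - t)) = exp (b x) Z\<^sub>\<tau> exp (b d)\<close> with an exponential martingale \<open>Z\<close>, and this is at least
\<open>exp (b x) Z\<^sub>\<tau> (1 + b d)\<close> by convexity. As \<open>d\<close> is known at time \<open>t + h\<close> or at ruin, whichever comes first,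
\<open>Z\<^sub>\<tau>\<close> may be replaced by the value of \<open>Z\<close> at that time in the mean of \<open>Z\<^sub>\<tau> d\<close>, and that value differs
from 1 by \<open>o(1)\<close> in \<open>L\<^sup>1\<close> (lemma \<open>expectation_discount_ge\<close>). Because \<open>\<lambda> \<le> 0\<close>, both transforms enter the
reward with a nonpositive sign, so the deviation gains at most \<open>(- b\<^sub>2 L / \<delta> + \<lambda> d\<^sub>2) E d\<close> and loses at
least \<open>exp (- \<delta> h) E d\<close>, up to \<open>o(h)\<close>. The hypothesis says that the first coefficient is at most 1, so
that the net gain is \<open>o(h)\<close> (lemma \<open>reward_le\<close>).

The differential equations follow by differentiating \<open>\<nu>\<close>. The expression to be maximised in \<open>u\<close> is
affine with slope \<open>1 - \<partial>\<nu>/\<partial>x\<close>, which is nonnegative by the same hypothesis, so that the maximum is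
attained at \<open>L\<close>. The transversality condition holds because \<open>\<nu>\<close> equals \<open>\<lambda> (1 - \<alpha>)\<close> at ruin and tends to
it uniformly as time goes to infinity.
\<close>

section \<open>The exponential martingale\<close>

text \<open>The exponential tilt that turns a centred normal density into a shifted one.\<close>

lemma normal_density_times_exp:
  fixes c s y :: real
  assumes "s > 0"
  shows "normal_density 0 s y * exp (c * y - c\<^sup>2 * s\<^sup>2 / 2) = normal_density (c * s\<^sup>2) s y"
proof -
  have "- (y - 0)\<^sup>2 / (2 * s\<^sup>2) + (c * y - c\<^sup>2 * s\<^sup>2 / 2) = - (y - c * s\<^sup>2)\<^sup>2 / (2 * s\<^sup>2)"
    using assms by (simp add: field_simps power2_eq_square)
  then show ?thesis
    unfolding normal_density_def by (simp add: mult.assoc flip: exp_add)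
qed

text \<open>A standard Brownian motion \<open>W\<close> on \<open>M\<close> with filtration \<open>F\<close>.\<close>

locale brownian_motion = prob_space M
  for M :: "'a measure" +
  fixes F :: "real \<Rightarrow> 'a measure" and W :: "real \<Rightarrow> 'a \<Rightarrow> real"
  assumes sbm: "standard_brownian_motion M F W"
begin

lemma space_F [simp]: "space (F t) = space M"
  using sbm unfolding standard_brownian_motion_def filtration_def by blast

lemma sets_F_mono: "s \<le> t \<Longrightarrow> sets (F s) \<subseteq> sets (F t)"
  using sbm unfolding standard_brownian_motion_def filtration_def by blast

lemma sets_F_M: "0 \<le> t \<Longrightarrow> sets (F t) \<subseteq> sets M"
  using sbm unfolding standard_brownian_motion_def subalgebra_def by blast

lemma measurable_F_mono:
  assumes "f \<in> borel_measurable (F s)" and "s \<le> t"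
  shows "f \<in> borel_measurable (F t)"
  using assms sets_F_mono[OF assms(2)] unfolding measurable_def by auto

lemma measurable_F_M:
  assumes "f \<in> borel_measurable (F s)" and "0 \<le> s"
  shows "f \<in> borel_measurable M"
  using assms sets_F_M[OF assms(2)] unfolding measurable_def by auto

lemma W_measurable_F: "0 \<le> s \<Longrightarrow> s \<le> t \<Longrightarrow> W s \<in> borel_measurable (F t)"
  using sbm measurable_F_mono unfolding standard_brownian_motion_def by blast

lemma W_measurable [measurable]: "0 \<le> s \<Longrightarrow> W s \<in> borel_measurable M"
  using W_measurable_F[of s s] measurable_F_M by blast

lemma W_continuous: "\<omega> \<in> space M \<Longrightarrow> continuous_on {0..} (\<lambda>t. W t \<omega>)"
  using sbm unfolding standard_brownian_motion_def by blast

lemma increment_mgf: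
  assumes "0 \<le> u" "u \<le> v"
  shows "integrable M (\<lambda>\<omega>. exp (c * (W v \<omega> - W u \<omega>) - c\<^sup>2 * (v - u) / 2))" (is "integrable M ?f")
    and "(\<integral>\<omega>. exp (c * (W v \<omega> - W u \<omega>) - c\<^sup>2 * (v - u) / 2) \<partial>M) = 1"
proof -
  have "integrable M ?f \<and> integral\<^sup>L M ?f = 1"
  proof (cases "u = v")
    case True
    then show ?thesis by (simp add: prob_space)
  next
    case False
    with assms have "u < v" by simp
    let ?s = "sqrt (v - u)"
    have D: "distributed M lborel (\<lambda>\<omega>. W v \<omega> - W u \<omega>) (normal_density 0 ?s)"
      using sbm \<open>0 \<le> u\<close> \<open>u < v\<close> unfolding standard_brownian_motion_def by blast
    have s: "?s > 0" "?s\<^sup>2 = v - u" using \<open>u < v\<close> by auto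
    have *: "(\<lambda>y. normal_density 0 ?s y * exp (c * y - c\<^sup>2 * (v - u) / 2))
        = normal_density (c * (v - u)) ?s"
      using normal_density_times_exp[OF s(1), of _ c] unfolding s(2) by blast
    have "integrable M (\<lambda>\<omega>. exp (c * (W v \<omega> - W u \<omega>) - c\<^sup>2 * (v - u) / 2))"
      by (subst distributed_integrable[OF D, symmetric]) (use s in \<open>simp_all add: *\<close>)
    moreover have "(\<integral>\<omega>. exp (c * (W v \<omega> - W u \<omega>) - c\<^sup>2 * (v - u) / 2) \<partial>M) = 1"
      by (subst distributed_integral[OF D, symmetric]) (use s in \<open>simp_all add: *\<close>)
    ultimately show ?thesis by simp
  qed
  then show "integrable M ?f" "integral\<^sup>L M ?f = 1" by auto
qed

text \<open>The exponential martingale \<open>s \<mapsto> exp (c (W\<^sub>s - W\<^sub>t) - c\<^sup>2 (s - t) / 2)\<close> of the Brownian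
  motion, normalised to have the value 1 at time \<open>t\<close>.\<close>

definition exp_mart :: "real \<Rightarrow> real \<Rightarrow> real \<Rightarrow> 'a \<Rightarrow> real" where
  "exp_mart c t s \<omega> = exp (c * (W s \<omega> - W t \<omega>) - c\<^sup>2 * (s - t) / 2)"

lemma exp_mart_pos: "exp_mart c t s \<omega> > 0"
  by (simp add: exp_mart_def)

lemma exp_mart_measurable_F: "0 \<le> t \<Longrightarrow> t \<le> s \<Longrightarrow> exp_mart c t s \<in> borel_measurable (F s)"
  unfolding exp_mart_def using W_measurable_F[of s s] W_measurable_F[of t s] by measurable

lemma exp_mart_measurable: "0 \<le> t \<Longrightarrow> t \<le> s \<Longrightarrow> exp_mart c t s \<in> borel_measurable M"
  using exp_mart_measurable_F measurable_F_M by fastforce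

lemma exp_mart_integrable: "0 \<le> t \<Longrightarrow> t \<le> s \<Longrightarrow> integrable M (exp_mart c t s)"
  unfolding exp_mart_def by (rule increment_mgf)

lemma integrable_bounded_times_exp_mart:
  assumes "0 \<le> t" "t \<le> s" "\<eta> \<in> borel_measurable M" "\<And>\<omega>. \<omega> \<in> space M \<Longrightarrow> \<bar>\<eta> \<omega>\<bar> \<le> K"
  shows "integrable M (\<lambda>\<omega>. \<eta> \<omega> * exp_mart c t s \<omega>)"
proof (rule Bochner_Integration.integrable_bound)
  show "integrable M (\<lambda>\<omega>. K * exp_mart c t s \<omega>)"
    using exp_mart_integrable[OF assms(1,2)] by simp
  show "AE \<omega> in M. norm (\<eta> \<omega> * exp_mart c t s \<omega>) \<le> norm (K * exp_mart c t s \<omega>)"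
    by (rule AE_I2) (use assms(4) exp_mart_pos[of c t s] in
      \<open>fastforce simp: abs_mult intro!: mult_mono intro: order_trans\<close>)
qed (use assms exp_mart_measurable in simp)

text \<open>The martingale property, tested against bounded \<open>F u\<close>-measurable \<open>\<eta>\<close>: the growth factor between
  \<open>u\<close> and \<open>v\<close> is independent of \<open>F u\<close> and has mean 1.\<close>

lemma exp_mart_martingale_step:
  assumes "0 \<le> t" "t \<le> u" "u \<le> v"
    and \<eta>: "\<eta> \<in> borel_measurable (F u)" "\<And>\<omega>. \<omega> \<in> space M \<Longrightarrow> \<bar>\<eta> \<omega>\<bar> \<le> K"
  shows "(\<integral>\<omega>. \<eta> \<omega> * exp_mart c t v \<omega> \<partial>M) = (\<integral>\<omega>. \<eta> \<omega> * exp_mart c t u \<omega> \<partial>M)"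
proof (cases "u = v")
  case False
  with assms have "u < v" "0 \<le> u" "0 \<le> v" by auto
  let ?D = "\<lambda>\<omega>. W v \<omega> - W u \<omega>"
  let ?f = "\<lambda>y. exp (c * y - c\<^sup>2 * (v - u) / 2)"
  let ?G = "\<lambda>\<omega>. \<eta> \<omega> * exp_mart c t u \<omega>"
  have G: "?G \<in> borel_measurable (F u)"
    using \<eta>(1) exp_mart_measurable_F[OF assms(1,2)] by simp
  have GM: "?G \<in> borel_measurable M" using G \<open>0 \<le> u\<close> by (rule measurable_F_M)
  have fM: "(\<lambda>\<omega>. ?f (?D \<omega>)) \<in> borel_measurable M"
    using W_measurable[OF \<open>0 \<le> u\<close>] W_measurable[OF \<open>0 \<le> v\<close>] by measurable
  have ind: "indep_set (sets (F u)) (sets (vimage_algebra (space M) ?D borel))"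
    using sbm \<open>0 \<le> u\<close> \<open>u < v\<close> unfolding standard_brownian_motion_def by blast
  have "indep_var borel ?G borel (\<lambda>\<omega>. ?f (?D \<omega>))"
    unfolding indep_var_def indep_vars_def2
  proof (intro conjI)
    show "\<forall>i\<in>UNIV. random_variable (case i of True \<Rightarrow> borel | False \<Rightarrow> borel)
        (case i of True \<Rightarrow> ?G | False \<Rightarrow> \<lambda>\<omega>. ?f (?D \<omega>))"
      using GM fM by (auto split: bool.split)
    show "indep_sets (\<lambda>i. {(case i of True \<Rightarrow> ?G | False \<Rightarrow> \<lambda>\<omega>. ?f (?D \<omega>)) -` A \<inter> space M |A.
         A \<in> sets (case i of True \<Rightarrow> borel | False \<Rightarrow> borel)}) UNIV"
    proof (rule indep_sets_mono_sets[OF ind[unfolded indep_set_def]])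
      fix i :: bool
      show "{(case i of True \<Rightarrow> ?G | False \<Rightarrow> \<lambda>\<omega>. ?f (?D \<omega>)) -` A \<inter> space M |A.
         A \<in> sets (case i of True \<Rightarrow> borel | False \<Rightarrow> borel)} \<subseteq>
         (case i of True \<Rightarrow> sets (F u) | False \<Rightarrow> sets (vimage_algebra (space M) ?D borel))"
      proof (cases i)
        case True
        then show ?thesis using measurable_sets[OF G] by auto
      next
        case False
        have "(\<lambda>\<omega>. ?f (?D \<omega>)) -` A \<inter> space M \<in> sets (vimage_algebra (space M) ?D borel)"
          if "A \<in> sets borel" for A :: "real set"
        proof -
          have "?f -` A \<in> sets borel"
            using measurable_sets[of ?f borel borel A] that by simp
          then have "?D -` (?f -` A) \<inter> space M \<in> sets (vimage_algebra (space M) ?D borel)"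
            by (rule in_vimage_algebra)
          then show ?thesis by (simp add: vimage_def)
        qed
        then show ?thesis using False by auto
      qed
    qed
  qed
  moreover have "integrable M ?G"
    by (rule integrable_bounded_times_exp_mart) (use assms measurable_F_M[OF \<eta>(1) \<open>0 \<le> u\<close>] in auto)
  moreover have "integrable M (\<lambda>\<omega>. ?f (?D \<omega>))"
    by (rule increment_mgf) (use \<open>0 \<le> u\<close> \<open>u < v\<close> in auto)
  ultimately have "(\<integral>\<omega>. ?G \<omega> * ?f (?D \<omega>) \<partial>M) = (\<integral>\<omega>. ?G \<omega> \<partial>M) * (\<integral>\<omega>. ?f (?D \<omega>) \<partial>M)"
    by (rule indep_var_lebesgue_integral)
  also have "(\<integral>\<omega>. ?f (?D \<omega>) \<partial>M) = 1"
    by (rule increment_mgf) (use \<open>0 \<le> u\<close> \<open>u < v\<close> in auto)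
  also have "(\<lambda>\<omega>. ?G \<omega> * ?f (?D \<omega>)) = (\<lambda>\<omega>. \<eta> \<omega> * exp_mart c t v \<omega>)"
    by (rule ext) (simp add: exp_mart_def mult.assoc flip: exp_add, simp add: field_simps)
  finally show ?thesis by simp
qed simp

text \<open>Optional stopping for \<open>\<rho>\<close> rounded up to the grid \<open>\<int> / N\<close>. The expectation is decomposed
  according to the value of the rounded stopping time.\<close>

lemma exp_mart_optional_stopping_grid:
  fixes \<rho> :: "'a \<Rightarrow> real" and N :: nat
  assumes "0 \<le> t" "t \<le> a" "N > 0"
    and \<rho>: "\<And>\<omega>. \<omega> \<in> space M \<Longrightarrow> a \<le> \<rho> \<omega> \<and> \<rho> \<omega> \<le> w"
    and \<rho>_stop: "\<And>s. a \<le> s \<Longrightarrow> {\<omega>\<in>space M. \<rho> \<omega> \<le> s} \<in> sets (F s)"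
    and \<xi>: "\<xi> \<in> borel_measurable (F a)" "\<And>\<omega>. \<omega> \<in> space M \<Longrightarrow> \<bar>\<xi> \<omega>\<bar> \<le> K"
  defines "\<rho>N \<equiv> \<lambda>\<omega>. real_of_int \<lceil>N * \<rho> \<omega>\<rceil> / N"
  shows "integrable M (\<lambda>\<omega>. \<xi> \<omega> * exp_mart c t (\<rho>N \<omega>) \<omega>)"
    and "(\<integral>\<omega>. \<xi> \<omega> * exp_mart c t (\<rho>N \<omega>) \<omega> \<partial>M) = (\<integral>\<omega>. \<xi> \<omega> * exp_mart c t a \<omega> \<partial>M)"
proof -
  obtain \<omega>0 where "\<omega>0 \<in> space M" using not_empty by blast
  then have "a \<le> w" using \<rho> by force
  let ?k = "\<lambda>\<omega>. \<lceil>N * \<rho> \<omega>\<rceil>"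
  define I where "I = {\<lceil>N * a\<rceil>..\<lceil>N * w\<rceil>}"
  have kI: "?k \<omega> \<in> I" if "\<omega> \<in> space M" for \<omega>
    using \<rho>[OF that] \<open>N > 0\<close> by (auto simp: I_def intro!: ceiling_mono)
  have Ia: "a \<le> real_of_int k / N" if "k \<in> I" for k
    using that \<open>N > 0\<close> by (auto simp: I_def field_simps ceiling_le_iff)
  \<comment> \<open>Rounding up may exceed \<open>w\<close>, but not \<open>w + 1\<close>; this is the common later time in the sum below.\<close>
  have Iw: "real_of_int k / N \<le> w + 1" if "k \<in> I" for k
  proof -
    have "real_of_int k \<le> real_of_int \<lceil>N * w\<rceil>" using that by (simp add: I_def)
    also have "\<dots> \<le> N * w + 1" by linarith
    also have "\<dots> \<le> N * (w + 1)" using \<open>N > 0\<close> by (simp add: algebra_simps)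
    finally show ?thesis using \<open>N > 0\<close> by (simp add: field_simps)
  qed
  have le_iff: "?k \<omega> \<le> k \<longleftrightarrow> \<rho> \<omega> \<le> real_of_int k / N" for \<omega> k
    using \<open>N > 0\<close> by (simp add: ceiling_le_iff field_simps)
  have ev: "{\<omega>\<in>space M. \<rho> \<omega> \<le> s'} \<in> sets (F s)" if "a \<le> s" "s' \<le> s" for s s'
  proof (cases "a \<le> s'")
    case True
    then show ?thesis using \<rho>_stop[of s'] sets_F_mono[OF that(2)] by auto
  next
    case False
    then have "{\<omega>\<in>space M. \<rho> \<omega> \<le> s'} = {}" using \<rho> by force
    then show ?thesis by (simp only: sets.empty_sets)
  qed
  have ev_k: "{\<omega>\<in>space M. ?k \<omega> = k} \<in> sets (F (k / N))" if "k \<in> I" for k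
  proof -
    have "{\<omega>\<in>space M. ?k \<omega> = k} =
        {\<omega>\<in>space M. \<rho> \<omega> \<le> real_of_int k / N} - {\<omega>\<in>space M. \<rho> \<omega> \<le> real_of_int (k - 1) / N}"
      unfolding le_iff[symmetric] by auto
    moreover have "real_of_int (k - 1) / N \<le> real_of_int k / N"
      using \<open>N > 0\<close> by (simp add: divide_right_mono)
    ultimately show ?thesis
      using ev[OF Ia[OF that], of "real_of_int k / N"] ev[OF Ia[OF that], of "real_of_int (k - 1) / N"]
      by auto
  qed
  define \<eta> where "\<eta> k \<omega> = indicator {\<omega>\<in>space M. ?k \<omega> = k} \<omega> * \<xi> \<omega>" for k \<omega>
  have \<eta>F: "\<eta> k \<in> borel_measurable (F (k / N))" if "k \<in> I" for k
    unfolding \<eta>_def using ev_k[OF that] measurable_F_mono[OF \<xi>(1) Ia[OF that]] by measurable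
  have K: "0 \<le> K" using \<xi>(2)[OF \<open>\<omega>0 \<in> space M\<close>] by linarith
  have \<eta>K: "\<bar>\<eta> k \<omega>\<bar> \<le> K" if "\<omega> \<in> space M" for k \<omega>
    using \<xi>(2)[OF that] K by (auto simp: \<eta>_def indicator_def)
  have \<eta>_sum: "(\<Sum>k\<in>I. \<eta> k \<omega> * f k) = \<xi> \<omega> * f (?k \<omega>)" if "\<omega> \<in> space M" for \<omega> and f :: "int \<Rightarrow> real"
  proof -
    have "(\<Sum>k\<in>I. \<eta> k \<omega> * f k) = (\<Sum>k\<in>I. if k = ?k \<omega> then \<xi> \<omega> * f k else 0)"
      using that by (intro sum.cong refl) (auto simp: \<eta>_def)
    also have "\<dots> = \<xi> \<omega> * f (?k \<omega>)"
      using kI[OF that] by (subst sum.delta) (auto simp: I_def)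
    finally show ?thesis .
  qed
  have int: "integrable M (\<lambda>\<omega>. \<eta> k \<omega> * exp_mart c t s \<omega>)" if "k \<in> I" "t \<le> s" for k s
  proof (rule integrable_bounded_times_exp_mart)
    have "0 \<le> real_of_int k / N" using Ia[OF that(1)] assms(1,2) by linarith
    then show "\<eta> k \<in> borel_measurable M" using \<eta>F[OF that(1)] measurable_F_M by blast
  qed (use that assms \<eta>K in auto)
  have eq: "(\<Sum>k\<in>I. \<eta> k \<omega> * exp_mart c t (k / N) \<omega>) = \<xi> \<omega> * exp_mart c t (\<rho>N \<omega>) \<omega>" if "\<omega> \<in> space M" for \<omega>
    using \<eta>_sum[OF that, of "\<lambda>k. exp_mart c t (k / N) \<omega>"] by (simp add: \<rho>N_def)
  have int_sum: "integrable M (\<lambda>\<omega>. \<Sum>k\<in>I. \<eta> k \<omega> * exp_mart c t (k / N) \<omega>)"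
    using int Ia assms(2) by (intro Bochner_Integration.integrable_sum) force
  then show "integrable M (\<lambda>\<omega>. \<xi> \<omega> * exp_mart c t (\<rho>N \<omega>) \<omega>)"
    by (subst (asm) Bochner_Integration.integrable_cong[OF refl eq]) auto
  have "(\<integral>\<omega>. \<xi> \<omega> * exp_mart c t (\<rho>N \<omega>) \<omega> \<partial>M) = (\<integral>\<omega>. (\<Sum>k\<in>I. \<eta> k \<omega> * exp_mart c t (k / N) \<omega>) \<partial>M)"
    using eq by (intro Bochner_Integration.integral_cong) auto
  also have "\<dots> = (\<Sum>k\<in>I. \<integral>\<omega>. \<eta> k \<omega> * exp_mart c t (k / N) \<omega> \<partial>M)"
    using int Ia assms(2) by (intro Bochner_Integration.integral_sum) force
  also have "\<dots> = (\<Sum>k\<in>I. \<integral>\<omega>. \<eta> k \<omega> * exp_mart c t (w + 1) \<omega> \<partial>M)"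
  proof (intro sum.cong refl)
    fix k assume k: "k \<in> I"
    show "(\<integral>\<omega>. \<eta> k \<omega> * exp_mart c t (k / N) \<omega> \<partial>M) = (\<integral>\<omega>. \<eta> k \<omega> * exp_mart c t (w + 1) \<omega> \<partial>M)"
      using exp_mart_martingale_step[OF assms(1) _ Iw[OF k] \<eta>F[OF k] \<eta>K] Ia[OF k] assms(2) by simp
  qed
  also have "\<dots> = (\<integral>\<omega>. (\<Sum>k\<in>I. \<eta> k \<omega> * exp_mart c t (w + 1) \<omega>) \<partial>M)"
    using int assms(2) \<open>a \<le> w\<close> by (intro Bochner_Integration.integral_sum[symmetric]) simp
  also have "\<dots> = (\<integral>\<omega>. \<xi> \<omega> * exp_mart c t (w + 1) \<omega> \<partial>M)"
    by (intro Bochner_Integration.integral_cong refl) (rule \<eta>_sum)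
  also have "\<dots> = (\<integral>\<omega>. \<xi> \<omega> * exp_mart c t a \<omega> \<partial>M)"
    by (rule exp_mart_martingale_step) (use assms \<open>a \<le> w\<close> in auto)
  finally show "(\<integral>\<omega>. \<xi> \<omega> * exp_mart c t (\<rho>N \<omega>) \<omega> \<partial>M) = (\<integral>\<omega>. \<xi> \<omega> * exp_mart c t a \<omega> \<partial>M)" .
qed

end

section \<open>Optional stopping\<close>

text \<open>A pointwise convergent sequence which is bounded in \<open>L\<^sup>2\<close> is uniformly integrable, so that
  the integrals converge as well.\<close>

lemma (in prob_space) integral_tendsto_of_L2_bounded:
  fixes f :: "nat \<Rightarrow> 'a \<Rightarrow> real"
  assumes meas: "\<And>n. f n \<in> borel_measurable M" "g \<in> borel_measurable M"
    and lim: "\<And>\<omega>. \<omega> \<in> space M \<Longrightarrow> (\<lambda>n. f n \<omega>) \<longlonglongrightarrow> g \<omega>"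
    and sq: "\<And>n. integrable M (\<lambda>\<omega>. (f n \<omega>)\<^sup>2)" "\<And>n. (\<integral>\<omega>. (f n \<omega>)\<^sup>2 \<partial>M) \<le> K"
  shows "integrable M (\<lambda>\<omega>. (g \<omega>)\<^sup>2)" and "(\<integral>\<omega>. (g \<omega>)\<^sup>2 \<partial>M) \<le> K"
    and "(\<lambda>n. \<integral>\<omega>. f n \<omega> \<partial>M) \<longlonglongrightarrow> (\<integral>\<omega>. g \<omega> \<partial>M)"
proof -
  have K: "0 \<le> K" by (rule order_trans[OF _ sq(2)[of 0]]) simp
  have "(\<integral>\<^sup>+\<omega>. ennreal ((g \<omega>)\<^sup>2) \<partial>M) = (\<integral>\<^sup>+\<omega>. liminf (\<lambda>n. ennreal ((f n \<omega>)\<^sup>2)) \<partial>M)"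
    using lim by (intro nn_integral_cong lim_imp_Liminf[symmetric])
      (auto intro!: tendsto_ennrealI tendsto_power)
  also have "\<dots> \<le> liminf (\<lambda>n. \<integral>\<^sup>+\<omega>. ennreal ((f n \<omega>)\<^sup>2) \<partial>M)"
    using meas by (intro nn_integral_liminf) simp
  also have "\<dots> \<le> ennreal K"
  proof (rule Liminf_le)
    show "\<forall>\<^sub>F n in sequentially. (\<integral>\<^sup>+\<omega>. ennreal ((f n \<omega>)\<^sup>2) \<partial>M) \<le> ennreal K"
      using sq by (intro always_eventually allI, subst nn_integral_eq_integral)
        (auto intro: ennreal_leI)
  qed simp
  finally have nn: "(\<integral>\<^sup>+\<omega>. ennreal ((g \<omega>)\<^sup>2) \<partial>M) \<le> ennreal K" .
  show g2: "integrable M (\<lambda>\<omega>. (g \<omega>)\<^sup>2)"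
    using meas nn by (intro integrableI_bounded) (auto simp: top.not_eq_extremum order_le_less_trans)
  show gK: "(\<integral>\<omega>. (g \<omega>)\<^sup>2 \<partial>M) \<le> K"
    using nn K g2 by (subst (asm) nn_integral_eq_integral) (auto simp: ennreal_le_iff)
  have intf: "integrable M (f n)" for n
    using square_integrable_imp_integrable[OF meas(1) sq(1)] .
  have intg: "integrable M g"
    using square_integrable_imp_integrable[OF meas(2) g2] .
  have d2: "integrable M (\<lambda>\<omega>. 2 * (f n \<omega>)\<^sup>2 + 2 * (g \<omega>)\<^sup>2)" for n
    using sq(1) g2 by simp
  \<comment> \<open>Cut off at level \<open>R\<close>; the part above \<open>R\<close> is controlled by the second moments.\<close>
  have bnd: "(\<integral>\<omega>. \<bar>f n \<omega> - g \<omega>\<bar> \<partial>M) \<le> (\<integral>\<omega>. min R \<bar>f n \<omega> - g \<omega>\<bar> \<partial>M) + 4 * K / R"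
    if "R > 0" for R n
  proof -
    have intm: "integrable M (\<lambda>\<omega>. min R \<bar>f n \<omega> - g \<omega>\<bar>)"
      using intf intg by (intro integrable_min) auto
    have "\<bar>d\<bar> \<le> min R \<bar>d\<bar> + d\<^sup>2 / R" for d :: real
    proof (cases "\<bar>d\<bar> \<le> R")
      case False
      then have "\<bar>d\<bar> * R \<le> \<bar>d\<bar> * \<bar>d\<bar>" by (intro mult_left_mono) auto
      then have "\<bar>d\<bar> * R \<le> d\<^sup>2" by (simp add: power2_eq_square)
      then have "\<bar>d\<bar> \<le> d\<^sup>2 / R" using that by (simp add: pos_le_divide_eq)
      then show ?thesis using that False by simp
    qed (use that in simp)
    note trunc = this
    have sq_diff: "(a - b)\<^sup>2 \<le> 2 * a\<^sup>2 + 2 * b\<^sup>2" for a b :: real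
      using zero_le_power2[of "a + b"] by (simp add: power2_eq_square algebra_simps)
    have "\<bar>f n \<omega> - g \<omega>\<bar> \<le> min R \<bar>f n \<omega> - g \<omega>\<bar> + (2 * (f n \<omega>)\<^sup>2 + 2 * (g \<omega>)\<^sup>2) / R" for \<omega>
    proof -
      have "(f n \<omega> - g \<omega>)\<^sup>2 / R \<le> (2 * (f n \<omega>)\<^sup>2 + 2 * (g \<omega>)\<^sup>2) / R"
        using that sq_diff by (intro divide_right_mono) auto
      then show ?thesis using trunc[of "f n \<omega> - g \<omega>"] by linarith
    qed
    then have "(\<integral>\<omega>. \<bar>f n \<omega> - g \<omega>\<bar> \<partial>M) \<le>
        (\<integral>\<omega>. min R \<bar>f n \<omega> - g \<omega>\<bar> + (2 * (f n \<omega>)\<^sup>2 + 2 * (g \<omega>)\<^sup>2) / R \<partial>M)"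
      using intf intg intm d2 by (intro integral_mono) auto
    also have "\<dots> = (\<integral>\<omega>. min R \<bar>f n \<omega> - g \<omega>\<bar> \<partial>M) + (2 * (\<integral>\<omega>. (f n \<omega>)\<^sup>2 \<partial>M) + 2 * (\<integral>\<omega>. (g \<omega>)\<^sup>2 \<partial>M)) / R"
      using intm d2 sq(1) g2 by simp
    also have "\<dots> \<le> (\<integral>\<omega>. min R \<bar>f n \<omega> - g \<omega>\<bar> \<partial>M) + 4 * K / R"
      using sq(2)[of n] gK that by (intro add_left_mono divide_right_mono) auto
    finally show ?thesis .
  qed
  have min0: "(\<lambda>n. \<integral>\<omega>. min R \<bar>f n \<omega> - g \<omega>\<bar> \<partial>M) \<longlonglongrightarrow> 0" if "R > 0" for R
  proof -
    have "(\<lambda>n. \<integral>\<omega>. min R \<bar>f n \<omega> - g \<omega>\<bar> \<partial>M) \<longlonglongrightarrow> (\<integral>\<omega>. 0 \<partial>M)"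
    proof (rule integral_dominated_convergence[where w = "\<lambda>_. R"])
      show "AE \<omega> in M. (\<lambda>n. min R \<bar>f n \<omega> - g \<omega>\<bar>) \<longlonglongrightarrow> 0"
      proof (rule AE_I2)
        fix \<omega> assume "\<omega> \<in> space M"
        then have "(\<lambda>n. min R \<bar>f n \<omega> - g \<omega>\<bar>) \<longlonglongrightarrow> min R \<bar>g \<omega> - g \<omega>\<bar>"
          by (intro tendsto_intros lim)
        then show "(\<lambda>n. min R \<bar>f n \<omega> - g \<omega>\<bar>) \<longlonglongrightarrow> 0" using that by simp
      qed
    qed (use meas that in auto)
    then show ?thesis by simp
  qed
  have "(\<lambda>n. \<integral>\<omega>. \<bar>f n \<omega> - g \<omega>\<bar> \<partial>M) \<longlonglongrightarrow> 0"
  proof (rule LIMSEQ_I)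
    fix e :: real assume "e > 0"
    define R where "R = 8 * (K + 1) / e"
    have "R > 0" using K \<open>e > 0\<close> by (simp add: R_def)
    have "4 * K / R < e / 2" using K \<open>e > 0\<close> by (simp add: R_def field_simps)
    obtain n0 where n0: "\<And>n. n \<ge> n0 \<Longrightarrow> \<bar>\<integral>\<omega>. min R \<bar>f n \<omega> - g \<omega>\<bar> \<partial>M\<bar> < e / 2"
      using LIMSEQ_D[OF min0[OF \<open>R > 0\<close>], of "e / 2"] \<open>e > 0\<close> by auto
    have "norm ((\<integral>\<omega>. \<bar>f n \<omega> - g \<omega>\<bar> \<partial>M) - 0) < e" if "n \<ge> n0" for n
      using bnd[OF \<open>R > 0\<close>, of n] n0[OF that] \<open>4 * K / R < e / 2\<close>
        Bochner_Integration.integral_nonneg[of M "\<lambda>\<omega>. \<bar>f n \<omega> - g \<omega>\<bar>"] by simp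
    then show "\<exists>no. \<forall>n\<ge>no. norm ((\<integral>\<omega>. \<bar>f n \<omega> - g \<omega>\<bar> \<partial>M) - 0) < e" by blast
  qed
  then have "(\<lambda>n. (\<integral>\<omega>. f n \<omega> \<partial>M) - (\<integral>\<omega>. g \<omega> \<partial>M)) \<longlonglongrightarrow> 0"
  proof (rule Lim_null_comparison[rotated], intro always_eventually allI)
    show "norm ((\<integral>\<omega>. f n \<omega> \<partial>M) - (\<integral>\<omega>. g \<omega> \<partial>M)) \<le> (\<integral>\<omega>. \<bar>f n \<omega> - g \<omega>\<bar> \<partial>M)" for n
      using integral_norm_bound[of M "\<lambda>\<omega>. f n \<omega> - g \<omega>"]
      by (simp only: Bochner_Integration.integral_diff[OF intf intg] real_norm_def)
  qed
  then show "(\<lambda>n. \<integral>\<omega>. f n \<omega> \<partial>M) \<longlonglongrightarrow> (\<integral>\<omega>. g \<omega> \<partial>M)"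
    by (rule LIM_zero_cancel)
qed

text \<open>Rounding up to the grids \<open>\<int> / (n + 1)\<close> approximates every real number from above.\<close>

lemma grid_approx:
  fixes r :: real
  assumes "r \<ge> a" "a \<ge> 0"
  shows "(\<lambda>n. real_of_int \<lceil>real (Suc n) * r\<rceil> / real (Suc n)) \<longlonglongrightarrow> r"
    and "a \<le> real_of_int \<lceil>real (Suc n) * r\<rceil> / real (Suc n)"
proof -
  have up: "real_of_int \<lceil>real (Suc n) * r\<rceil> / real (Suc n) \<le> r + 1 / real (Suc n)" for n
  proof -
    have "real_of_int \<lceil>real (Suc n) * r\<rceil> \<le> real (Suc n) * r + 1" by linarith
    then have "real_of_int \<lceil>real (Suc n) * r\<rceil> / real (Suc n) \<le> (real (Suc n) * r + 1) / real (Suc n)"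
      by (intro divide_right_mono) auto
    then show ?thesis by (simp add: add_divide_distrib)
  qed
  have lo: "r \<le> real_of_int \<lceil>real (Suc n) * r\<rceil> / real (Suc n)" for n
    by (subst pos_le_divide_eq) (auto simp: mult.commute le_of_int_ceiling)
  have up_lim: "(\<lambda>n. r + 1 / real (Suc n)) \<longlonglongrightarrow> r"
    using tendsto_add[OF tendsto_const LIMSEQ_Suc[OF lim_1_over_n], of r] by (simp only: add_0_right)
  show "(\<lambda>n. real_of_int \<lceil>real (Suc n) * r\<rceil> / real (Suc n)) \<longlonglongrightarrow> r"
  proof (rule tendsto_sandwich[OF _ _ tendsto_const up_lim])
    show "\<forall>\<^sub>F n in sequentially. r \<le> real_of_int \<lceil>real (Suc n) * r\<rceil> / real (Suc n)"
      by (rule always_eventually) (rule allI, rule lo)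
    show "\<forall>\<^sub>F n in sequentially. real_of_int \<lceil>real (Suc n) * r\<rceil> / real (Suc n) \<le> r + 1 / real (Suc n)"
      by (rule always_eventually) (rule allI, rule up)
  qed
  show "a \<le> real_of_int \<lceil>real (Suc n) * r\<rceil> / real (Suc n)"
    by (rule order_trans[OF assms(1) lo])
qed

text \<open>A process with continuous paths is jointly measurable, because it is the pointwise limit of
  the processes that are frozen between the points of a grid.\<close>

lemma continuous_process_measurable:
  fixes Y :: "real \<Rightarrow> 'a \<Rightarrow> real"
  assumes "0 \<le> a" and cont: "\<And>\<omega>. \<omega> \<in> space M \<Longrightarrow> continuous_on {a..} (\<lambda>s. Y s \<omega>)"
    and meas: "\<And>s. a \<le> s \<Longrightarrow> Y s \<in> borel_measurable M"
    and \<tau>: "\<tau> \<in> borel_measurable N" "\<And>z. z \<in> space N \<Longrightarrow> a \<le> \<tau> z"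
    and p: "p \<in> measurable N M"
  shows "(\<lambda>z. Y (\<tau> z) (p z)) \<in> borel_measurable N"
proof (rule borel_measurable_LIMSEQ_real)
  let ?g = "\<lambda>n z. real_of_int \<lceil>real (Suc n) * \<tau> z\<rceil> / real (Suc n)"
  show "(\<lambda>n. Y (?g n z) (p z)) \<longlonglongrightarrow> Y (\<tau> z) (p z)" if "z \<in> space N" for z
  proof -
    have "p z \<in> space M" using p that by (rule measurable_space)
    then have "continuous_on {a..} (\<lambda>s. Y s (p z))" by (rule cont)
    then show ?thesis
      using grid_approx[OF \<tau>(2)[OF that] assms(1)] \<tau>(2)[OF that]
      by (intro continuous_on_tendsto_compose[where f = "\<lambda>s. Y s (p z)"]) auto
  qed
  show "(\<lambda>z. Y (?g n z) (p z)) \<in> borel_measurable N" for n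
  proof -
    let ?q = "\<lambda>k. real_of_int k / real (Suc n)"
    let ?Z = "\<lambda>k z. if a \<le> ?q k then Y (?q k) (p z) else 0"
    have "(\<lambda>z. ?Z \<lceil>real (Suc n) * \<tau> z\<rceil> z) \<in> borel_measurable N"
    proof (rule measurable_compose_countable[where f = ?Z])
      show "?Z k \<in> borel_measurable N" for k
        using measurable_compose[OF p meas[of "?q k"]] by (cases "a \<le> ?q k") simp_all
      show "(\<lambda>z. \<lceil>real (Suc n) * \<tau> z\<rceil>) \<in> measurable N (count_space UNIV)"
        using \<tau>(1) by measurable
    qed
    moreover have "(\<lambda>z. ?Z \<lceil>real (Suc n) * \<tau> z\<rceil> z) \<in> borel_measurable N \<longleftrightarrow>
        (\<lambda>z. Y (?g n z) (p z)) \<in> borel_measurable N"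
      using grid_approx(2)[OF \<tau>(2) assms(1)] by (intro measurable_cong) simp
    ultimately show ?thesis by (rule iffD1[rotated])
  qed
qed

context brownian_motion
begin

lemma exp_mart_continuous:
  assumes "0 \<le> t" "\<omega> \<in> space M"
  shows "continuous_on {t..} (\<lambda>s. exp_mart c t s \<omega>)"
  unfolding exp_mart_def
  by (intro continuous_intros continuous_on_subset[OF W_continuous[OF assms(2)]]) (use assms in auto)

lemma exp_mart_at_measurable:
  assumes "0 \<le> t" "\<rho> \<in> borel_measurable M" "\<And>\<omega>. \<omega> \<in> space M \<Longrightarrow> t \<le> \<rho> \<omega>"
  shows "(\<lambda>\<omega>. exp_mart c t (\<rho> \<omega>) \<omega>) \<in> borel_measurable M"
  by (rule continuous_process_measurable[OF assms(1) exp_mart_continuous[OF assms(1)]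
        exp_mart_measurable[OF assms(1)] assms(2,3) measurable_ident_sets]) simp_all

text \<open>The square is the martingale for \<open>2 c\<close>, up to a deterministic factor.\<close>

lemma exp_mart_square: "(exp_mart c t s \<omega>)\<^sup>2 = exp (c\<^sup>2 * (s - t)) * exp_mart (2 * c) t s \<omega>"
proof -
  have "2 * (c * (W s \<omega> - W t \<omega>) - c\<^sup>2 * (s - t) / 2) =
      c\<^sup>2 * (s - t) + (2 * c * (W s \<omega> - W t \<omega>) - (2 * c)\<^sup>2 * (s - t) / 2)"
    by (simp add: power2_eq_square field_simps)
  then show ?thesis
    unfolding exp_mart_def by (simp flip: exp_add exp_of_nat_mult)
qed

text \<open>Optional stopping for a bounded stopping time \<open>\<rho> \<ge> a\<close>. The approximating grid-valued
  stopping times decrease to \<open>\<rho>\<close>, and along them the exponential martingale stays bounded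
  in \<open>L\<^sup>2\<close> because its square is, up to a bounded factor, an exponential martingale again.\<close>

lemma exp_mart_optional_stopping:
  fixes \<rho> :: "'a \<Rightarrow> real"
  assumes "0 \<le> t" "t \<le> a"
    and \<rho>: "\<And>\<omega>. \<omega> \<in> space M \<Longrightarrow> a \<le> \<rho> \<omega> \<and> \<rho> \<omega> \<le> w"
    and \<rho>_stop: "\<And>s. a \<le> s \<Longrightarrow> {\<omega>\<in>space M. \<rho> \<omega> \<le> s} \<in> sets (F s)"
    and \<rho>_meas: "\<rho> \<in> borel_measurable M"
  shows "integrable M (\<lambda>\<omega>. (exp_mart c t (\<rho> \<omega>) \<omega>)\<^sup>2)"
    and "\<lbrakk>\<xi> \<in> borel_measurable (F a); \<And>\<omega>. \<omega> \<in> space M \<Longrightarrow> \<bar>\<xi> \<omega>\<bar> \<le> K\<rbrakk> \<Longrightarrow>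
      (\<integral>\<omega>. \<xi> \<omega> * exp_mart c t (\<rho> \<omega>) \<omega> \<partial>M) = (\<integral>\<omega>. \<xi> \<omega> * exp_mart c t a \<omega> \<partial>M)"
proof -
  obtain \<omega>0 where "\<omega>0 \<in> space M" using not_empty by blast
  then have "a \<le> w" using \<rho> by force
  define g where "g n \<omega> = real_of_int \<lceil>real (Suc n) * \<rho> \<omega>\<rceil> / real (Suc n)" for n \<omega>
  have a0: "0 \<le> a" using assms by simp
  have g: "a \<le> g n \<omega>" "g n \<omega> \<le> w + 1" "(\<lambda>n. g n \<omega>) \<longlonglongrightarrow> \<rho> \<omega>" if "\<omega> \<in> space M" for n \<omega>
  proof -
    show "a \<le> g n \<omega>" "(\<lambda>n. g n \<omega>) \<longlonglongrightarrow> \<rho> \<omega>"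
      using grid_approx[OF _ a0, of "\<rho> \<omega>"] \<rho>[OF that] by (auto simp: g_def)
    have "real_of_int \<lceil>real (Suc n) * \<rho> \<omega>\<rceil> \<le> real (Suc n) * \<rho> \<omega> + 1" by linarith
    also have "\<dots> \<le> real (Suc n) * w + real (Suc n)"
      using \<rho>[OF that] by (intro add_mono mult_left_mono) auto
    also have "\<dots> = (w + 1) * real (Suc n)" by (simp add: algebra_simps)
    finally show "g n \<omega> \<le> w + 1" by (simp add: g_def pos_divide_le_eq)
  qed
  have g_meas: "g n \<in> borel_measurable M" for n
    unfolding g_def using \<rho>_meas by measurable
  have Z_meas: "(\<lambda>\<omega>. exp_mart c t (g n \<omega>) \<omega>) \<in> borel_measurable M"
    "(\<lambda>\<omega>. exp_mart c t (\<rho> \<omega>) \<omega>) \<in> borel_measurable M" for c n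
    by (rule exp_mart_at_measurable[OF assms(1)];
        use g_meas \<rho>_meas order_trans[OF assms(2) g(1)] order_trans[OF assms(2) conjunct1[OF \<rho>]] in simp)+
  have Z_lim: "(\<lambda>n. exp_mart c t (g n \<omega>) \<omega>) \<longlonglongrightarrow> exp_mart c t (\<rho> \<omega>) \<omega>" if "\<omega> \<in> space M" for \<omega>
  proof (rule continuous_on_tendsto_compose[OF exp_mart_continuous[OF assms(1) that] g(3)[OF that]])
    show "\<rho> \<omega> \<in> {t..}" using \<rho>[OF that] assms(2) by auto
    show "\<forall>\<^sub>F n in sequentially. g n \<omega> \<in> {t..}"
      by (intro always_eventually allI) (use order_trans[OF assms(2) g(1)[OF that]] in auto)
  qed
  note grid = exp_mart_optional_stopping_grid[OF assms(1,2) zero_less_Suc \<rho> \<rho>_stop, folded g_def]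
  have sq: "integrable M (\<lambda>\<omega>. (exp_mart c t (g n \<omega>) \<omega>)\<^sup>2)"
    "(\<integral>\<omega>. (exp_mart c t (g n \<omega>) \<omega>)\<^sup>2 \<partial>M) \<le> exp (c\<^sup>2 * (w + 1 - t))" for n
  proof -
    let ?B = "exp (c\<^sup>2 * (w + 1 - t))"
    have i: "integrable M (\<lambda>\<omega>. exp_mart (2 * c) t (g n \<omega>) \<omega>)"
      using grid(1)[of "\<lambda>_. 1" 1 "2 * c" n] by simp
    have e: "(\<integral>\<omega>. exp_mart (2 * c) t (g n \<omega>) \<omega> \<partial>M) = 1"
      using grid(2)[of "\<lambda>_. 1" 1 "2 * c" n] increment_mgf(2)[OF assms(1,2), of "2 * c"]
      by (simp add: exp_mart_def)
    have b: "(exp_mart c t (g n \<omega>) \<omega>)\<^sup>2 \<le> ?B * exp_mart (2 * c) t (g n \<omega>) \<omega>" if "\<omega> \<in> space M" for \<omega>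
      unfolding exp_mart_square using g(2)[OF that, of n] exp_mart_pos[of "2 * c" t "g n \<omega>" \<omega>]
      by (intro mult_right_mono) (auto intro!: mult_left_mono)
    show *: "integrable M (\<lambda>\<omega>. (exp_mart c t (g n \<omega>) \<omega>)\<^sup>2)"
      by (rule Bochner_Integration.integrable_bound[of M "\<lambda>\<omega>. ?B * exp_mart (2 * c) t (g n \<omega>) \<omega>"])
        (use i b Z_meas(1) in \<open>auto intro: order_trans[OF _ abs_ge_self]\<close>)
    have "(\<integral>\<omega>. (exp_mart c t (g n \<omega>) \<omega>)\<^sup>2 \<partial>M) \<le> (\<integral>\<omega>. ?B * exp_mart (2 * c) t (g n \<omega>) \<omega> \<partial>M)"
      using i b * by (intro integral_mono) auto
    then show "(\<integral>\<omega>. (exp_mart c t (g n \<omega>) \<omega>)\<^sup>2 \<partial>M) \<le> ?B" using e by simp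
  qed
  show "integrable M (\<lambda>\<omega>. (exp_mart c t (\<rho> \<omega>) \<omega>)\<^sup>2)"
    by (rule integral_tendsto_of_L2_bounded(1)[OF Z_meas Z_lim sq])
  assume \<xi>: "\<xi> \<in> borel_measurable (F a)" "\<And>\<omega>. \<omega> \<in> space M \<Longrightarrow> \<bar>\<xi> \<omega>\<bar> \<le> K"
  have \<xi>M: "\<xi> \<in> borel_measurable M" using \<xi>(1) a0 by (rule measurable_F_M)
  have K: "0 \<le> K" using \<xi>(2)[OF \<open>\<omega>0 \<in> space M\<close>] by linarith
  have b: "(\<xi> \<omega> * z)\<^sup>2 \<le> K\<^sup>2 * z\<^sup>2" if "\<omega> \<in> space M" for \<omega> z
    using \<xi>(2)[OF that] K unfolding power_mult_distrib
    by (intro mult_right_mono) (auto simp: abs_le_square_iff[symmetric])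
  have sq\<xi>: "integrable M (\<lambda>\<omega>. (\<xi> \<omega> * exp_mart c t (g n \<omega>) \<omega>)\<^sup>2)"
    "(\<integral>\<omega>. (\<xi> \<omega> * exp_mart c t (g n \<omega>) \<omega>)\<^sup>2 \<partial>M) \<le> K\<^sup>2 * exp (c\<^sup>2 * (w + 1 - t))" for n
  proof -
    show *: "integrable M (\<lambda>\<omega>. (\<xi> \<omega> * exp_mart c t (g n \<omega>) \<omega>)\<^sup>2)"
      by (rule Bochner_Integration.integrable_bound[of M "\<lambda>\<omega>. K\<^sup>2 * (exp_mart c t (g n \<omega>) \<omega>)\<^sup>2"])
        (use sq(1) b Z_meas(1) \<xi>M in auto)
    have "(\<integral>\<omega>. (\<xi> \<omega> * exp_mart c t (g n \<omega>) \<omega>)\<^sup>2 \<partial>M) \<le> (\<integral>\<omega>. K\<^sup>2 * (exp_mart c t (g n \<omega>) \<omega>)\<^sup>2 \<partial>M)"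
      using sq(1) b * by (intro integral_mono) auto
    then show "(\<integral>\<omega>. (\<xi> \<omega> * exp_mart c t (g n \<omega>) \<omega>)\<^sup>2 \<partial>M) \<le> K\<^sup>2 * exp (c\<^sup>2 * (w + 1 - t))"
      using mult_left_mono[OF sq(2)[of n], of "K\<^sup>2"] by simp
  qed
  have "(\<lambda>n. \<integral>\<omega>. \<xi> \<omega> * exp_mart c t (g n \<omega>) \<omega> \<partial>M) \<longlonglongrightarrow> (\<integral>\<omega>. \<xi> \<omega> * exp_mart c t (\<rho> \<omega>) \<omega> \<partial>M)"
  proof (rule integral_tendsto_of_L2_bounded(3)[OF _ _ _ sq\<xi>])
    show "(\<lambda>n. \<xi> \<omega> * exp_mart c t (g n \<omega>) \<omega>) \<longlonglongrightarrow> \<xi> \<omega> * exp_mart c t (\<rho> \<omega>) \<omega>"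
      if "\<omega> \<in> space M" for \<omega>
      by (intro tendsto_mult tendsto_const Z_lim that)
  qed (use Z_meas \<xi>M in simp_all)
  moreover have "(\<integral>\<omega>. \<xi> \<omega> * exp_mart c t (g n \<omega>) \<omega> \<partial>M) = (\<integral>\<omega>. \<xi> \<omega> * exp_mart c t a \<omega> \<partial>M)" for n
    by (rule grid(2)[OF _ _ \<xi>])
  ultimately show "(\<integral>\<omega>. \<xi> \<omega> * exp_mart c t (\<rho> \<omega>) \<omega> \<partial>M) = (\<integral>\<omega>. \<xi> \<omega> * exp_mart c t a \<omega> \<partial>M)"
    by (simp add: LIMSEQ_const_iff)
qed

end

section \<open>The ruin time of a continuous adapted process\<close>

lemma exp_neg_tendsto_0:
  fixes q :: real
  assumes "q > 0"
  shows "((\<lambda>w. exp (- q * (w - r))) \<longlongrightarrow> 0) at_top"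
proof (rule filterlim_compose[OF exp_at_bot])
  have "filterlim (\<lambda>w. w - r) at_top at_top"
    using filterlim_tendsto_add_at_top[OF tendsto_const filterlim_ident, of "- r"] by simp
  then show "filterlim (\<lambda>w. - q * (w - r)) at_bot at_top"
    using assms by (intro filterlim_tendsto_neg_mult_at_bot[OF tendsto_const]) simp_all
qed

text \<open>A process \<open>Y\<close> on \<open>[t, \<infinity>)\<close> that is adapted and has continuous paths, with ruin time \<open>\<tau>\<close>, the first time
  at which \<open>Y\<close> is not positive.\<close>

locale continuous_adapted = brownian_motion M F W
  for M :: "'a measure" and F :: "real \<Rightarrow> 'a measure" and W :: "real \<Rightarrow> 'a \<Rightarrow> real" +
  fixes t :: real and Y :: "real \<Rightarrow> 'a \<Rightarrow> real"
  assumes t_nonneg: "0 \<le> t"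
    and Y_adapted: "\<And>s. t \<le> s \<Longrightarrow> Y s \<in> borel_measurable (F s)"
    and Y_continuous: "\<And>\<omega>. \<omega> \<in> space M \<Longrightarrow> continuous_on {t..} (\<lambda>s. Y s \<omega>)"
begin

abbreviation \<tau> :: "'a \<Rightarrow> ereal" where
  "\<tau> \<equiv> ruin_time t Y"

lemma ruin_time_ge: "ereal t \<le> \<tau> \<omega>"
  unfolding ruin_time_def by (rule Inf_greatest) auto

lemma positive_before_ruin:
  assumes "t \<le> s" "ereal s < \<tau> \<omega>"
  shows "0 < Y s \<omega>"
proof (rule ccontr)
  assume "\<not> 0 < Y s \<omega>"
  then have "\<tau> \<omega> \<le> ereal s"
    unfolding ruin_time_def using assms(1) by (intro Inf_lower) auto
  then show False using assms(2) by simp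
qed

lemma ruin_time_cases:
  assumes "\<omega> \<in> space M"
  obtains (infinite) "\<tau> \<omega> = \<infinity>"
    | (finite) T where "\<tau> \<omega> = ereal T" "t \<le> T" "Y T \<omega> \<le> 0"
proof (cases "{s. t \<le> s \<and> Y s \<omega> \<le> 0} = {}")
  case True
  then have "\<tau> \<omega> = \<infinity>" unfolding ruin_time_def by (simp only: image_empty Inf_empty top_ereal_def)
  then show thesis by (rule infinite)
next
  case False
  let ?S = "{s. t \<le> s \<and> Y s \<omega> \<le> 0}"
  have "?S = {t..} \<inter> (\<lambda>s. Y s \<omega>) -` {..0}" by auto
  then have cl: "closed ?S"
    using continuous_closed_preimage[OF Y_continuous[OF assms] closed_atLeast closed_atMost, of 0] by simp
  have bdd: "bdd_below ?S" by (auto intro!: bdd_belowI[of _ t])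
  have mem: "Inf ?S \<in> ?S" by (rule closed_contains_Inf[OF False bdd cl])
  have "\<tau> \<omega> = ereal (Inf ?S)"
    unfolding ruin_time_def
  proof (rule antisym)
    show "Inf (ereal ` ?S) \<le> ereal (Inf ?S)" using mem by (intro Inf_lower) blast
    show "ereal (Inf ?S) \<le> Inf (ereal ` ?S)"
      using cInf_lower[OF _ bdd] by (intro Inf_greatest) auto
  qed
  then show thesis using mem by (intro finite) auto
qed

lemma ruin_time_le_iff:
  assumes "\<omega> \<in> space M"
  shows "\<tau> \<omega> \<le> ereal s \<longleftrightarrow> (\<exists>u\<in>{t..s}. Y u \<omega> \<le> 0)"
proof
  assume "\<tau> \<omega> \<le> ereal s"
  with assms show "\<exists>u\<in>{t..s}. Y u \<omega> \<le> 0" by (cases rule: ruin_time_cases) auto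
next
  assume "\<exists>u\<in>{t..s}. Y u \<omega> \<le> 0"
  then obtain u where u: "t \<le> u" "u \<le> s" "Y u \<omega> \<le> 0" by auto
  then have "\<tau> \<omega> \<le> ereal u" unfolding ruin_time_def by (intro Inf_lower) auto
  then show "\<tau> \<omega> \<le> ereal s" using u(2) order_trans by fastforce
qed

text \<open>The infimum of a continuous path over \<open>{t..s}\<close> is determined by its values at rational
  times, clamped to the interval.\<close>

lemma ruin_time_le_event:
  assumes "t \<le> s"
  shows "{\<omega>\<in>space M. \<tau> \<omega> \<le> ereal s} \<in> sets (F s)"
proof -
  let ?q = "\<lambda>q::rat. min s (max t (of_rat q))"
  have "{\<omega>\<in>space M. \<tau> \<omega> \<le> ereal s} =
      {\<omega>\<in>space (F s). \<forall>n::nat. \<exists>q. Y (?q q) \<omega> < 1 / real (Suc n)}"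
  proof -
    have "\<tau> \<omega> \<le> ereal s \<longleftrightarrow> (\<forall>n::nat. \<exists>q. Y (?q q) \<omega> < 1 / real (Suc n))" if \<omega>: "\<omega> \<in> space M" for \<omega>
      unfolding ruin_time_le_iff[OF \<omega>]
    proof
      assume "\<exists>u\<in>{t..s}. Y u \<omega> \<le> 0"
      then obtain u where u: "t \<le> u" "u \<le> s" "Y u \<omega> \<le> 0" by auto
      show "\<forall>n::nat. \<exists>q. Y (?q q) \<omega> < 1 / real (Suc n)"
      proof
        fix n :: nat
        have "0 < 1 / real (Suc n)" by simp
        then obtain d where d: "d > 0"
          "\<And>v. v \<in> {t..} \<Longrightarrow> dist v u < d \<Longrightarrow> dist (Y v \<omega>) (Y u \<omega>) < 1 / real (Suc n)"
          using Y_continuous[OF \<omega>] u(1) unfolding continuous_on_iff by (meson atLeast_iff)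
        obtain q where q: "u < real_of_rat q" "real_of_rat q < u + d"
          using of_rat_dense[of u "u + d"] d(1) by auto
        have "dist (?q q) u < d" "?q q \<in> {t..}"
          using q u assms by (auto simp: dist_real_def min_def max_def)
        then have "dist (Y (?q q) \<omega>) (Y u \<omega>) < 1 / real (Suc n)" by (intro d(2))
        then have "Y (?q q) \<omega> < 1 / real (Suc n)" using u(3) unfolding dist_real_def by linarith
        then show "\<exists>q. Y (?q q) \<omega> < 1 / real (Suc n)" by blast
      qed
    next
      assume *: "\<forall>n::nat. \<exists>q. Y (?q q) \<omega> < 1 / real (Suc n)"
      have "continuous_on {t..s} (\<lambda>u. Y u \<omega>)"
        using Y_continuous[OF \<omega>] by (rule continuous_on_subset) auto
      then obtain u where u: "u \<in> {t..s}" "\<And>v. v \<in> {t..s} \<Longrightarrow> Y u \<omega> \<le> Y v \<omega>"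
        using continuous_attains_inf[of "{t..s}" "\<lambda>u. Y u \<omega>"] assms by auto
      have "Y u \<omega> \<le> 0"
      proof (rule ccontr)
        assume "\<not> Y u \<omega> \<le> 0"
        then obtain n where "1 / real (Suc n) < Y u \<omega>"
          using nat_approx_posE[of "Y u \<omega>"] by (auto simp: not_le)
        moreover obtain q where "Y (?q q) \<omega> < 1 / real (Suc n)" using * by blast
        moreover have "Y u \<omega> \<le> Y (?q q) \<omega>" using assms by (intro u(2)) (auto simp: min_def max_def)
        ultimately show False by linarith
      qed
      then show "\<exists>u\<in>{t..s}. Y u \<omega> \<le> 0" using u(1) by blast
    qed
    then show ?thesis by auto
  qed
  also have "\<dots> \<in> sets (F s)"
  proof -
    define Z where "Z q = Y (?q q)" for q
    have [measurable]: "Z q \<in> borel_measurable (F s)" for q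
      unfolding Z_def by (rule measurable_F_mono[OF Y_adapted]) (use assms in simp_all)
    have "{\<omega>\<in>space (F s). \<forall>n::nat. \<exists>q. Z q \<omega> < 1 / real (Suc n)} \<in> sets (F s)"
      by measurable
    then show ?thesis unfolding Z_def .
  qed
  finally show ?thesis .
qed

lemma survival_event:
  assumes "t \<le> s"
  shows "{\<omega>\<in>space M. ereal s < \<tau> \<omega>} \<in> sets (F s)"
proof -
  have "{\<omega>\<in>space M. ereal s < \<tau> \<omega>} = space (F s) - {\<omega>\<in>space M. \<tau> \<omega> \<le> ereal s}" by auto
  then show ?thesis using ruin_time_le_event[OF assms] by (metis sets.compl_sets)
qed

lemma ruin_time_le_event_M: "{\<omega>\<in>space M. \<tau> \<omega> \<le> ereal s} \<in> sets M"
proof (cases "t \<le> s")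
  case True
  then show ?thesis using ruin_time_le_event[OF True] sets_F_M[of s] t_nonneg by auto
next
  case False
  have "\<not> \<tau> \<omega> \<le> ereal s" for \<omega>
    using ruin_time_ge[of \<omega>] False by (metis ereal_less_eq(3) order_trans)
  then show ?thesis by simp
qed

lemma ruin_time_measurable: "\<tau> \<in> borel_measurable M"
proof (rule borel_measurableI_le)
  fix y :: ereal
  show "{\<omega>\<in>space M. \<tau> \<omega> \<le> y} \<in> sets M"
  proof (cases y)
    case (real s)
    then show ?thesis using ruin_time_le_event_M by simp
  next
    case MInf
    have "\<not> \<tau> \<omega> \<le> y" for \<omega> using ruin_time_ge[of \<omega>] MInf by auto
    then show ?thesis by simp
  qed simp
qed

text \<open>The bounded stopping time \<open>min w \<tau>\<close>, as a real number.\<close>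

definition stopped :: "real \<Rightarrow> 'a \<Rightarrow> real" where
  "stopped w \<omega> = real_of_ereal (min (ereal w) (\<tau> \<omega>))"

lemma stopped_before: "ereal w \<le> \<tau> \<omega> \<Longrightarrow> stopped w \<omega> = w"
  by (simp add: stopped_def min_def)

lemma stopped_after: "\<tau> \<omega> = ereal T \<Longrightarrow> T \<le> w \<Longrightarrow> stopped w \<omega> = T"
  by (simp add: stopped_def min_def)

lemma stopped_props:
  assumes "t \<le> w"
  shows "t \<le> stopped w \<omega>" "stopped w \<omega> \<le> w" "ereal (stopped w \<omega>) \<le> \<tau> \<omega>"
  using assms ruin_time_ge[of \<omega>] by (cases "\<tau> \<omega>"; auto simp: stopped_def min_def)+

lemma stopped_le_iff:
  assumes "t \<le> w" "s < w"
  shows "stopped w \<omega> \<le> s \<longleftrightarrow> \<tau> \<omega> \<le> ereal s"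
  using assms ruin_time_ge[of \<omega>] by (cases "\<tau> \<omega>"; auto simp: stopped_def min_def)

lemma stopped_event:
  assumes "t \<le> w" "t \<le> s"
  shows "{\<omega>\<in>space M. stopped w \<omega> \<le> s} \<in> sets (F s)"
proof (cases "s < w")
  case True
  then show ?thesis using stopped_le_iff[OF assms(1) True] ruin_time_le_event[OF assms(2)] by simp
next
  case False
  then have "{\<omega>\<in>space M. stopped w \<omega> \<le> s} = space (F s)"
    using order_trans[OF stopped_props(2)[OF assms(1)], of s] by auto
  then show ?thesis by (metis sets.top)
qed

lemma stopped_measurable: "stopped w \<in> borel_measurable M"
  unfolding stopped_def using ruin_time_measurable by measurable

lemma at_stopped_measurable:
  fixes Z :: "real \<Rightarrow> 'a \<Rightarrow> real"
  assumes "t \<le> w" "\<And>s. t \<le> s \<Longrightarrow> Z s \<in> borel_measurable M"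
    and "\<And>\<omega>. \<omega> \<in> space M \<Longrightarrow> continuous_on {t..} (\<lambda>s. Z s \<omega>)"
  shows "(\<lambda>\<omega>. Z (stopped w \<omega>) \<omega>) \<in> borel_measurable M"
  by (rule continuous_process_measurable[OF t_nonneg assms(3,2) stopped_measurable
        stopped_props(1)[OF assms(1)] measurable_ident_sets]) simp_all

lemma Y_measurable: "t \<le> s \<Longrightarrow> Y s \<in> borel_measurable M"
  by (rule measurable_F_M[OF Y_adapted order_trans[OF t_nonneg]])

lemma Y_stopped_measurable: "t \<le> w \<Longrightarrow> (\<lambda>\<omega>. Y (stopped w \<omega>) \<omega>) \<in> borel_measurable M"
  by (rule at_stopped_measurable[OF _ Y_measurable Y_continuous])

lemma exp_mart_stopped_measurable: "t \<le> w \<Longrightarrow> (\<lambda>\<omega>. exp_mart c t (stopped w \<omega>) \<omega>) \<in> borel_measurable M"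
  by (rule at_stopped_measurable[OF _ exp_mart_measurable[OF t_nonneg] exp_mart_continuous[OF t_nonneg]])

text \<open>The discount factor \<open>exp (- q (\<tau> - t))\<close>, which is 0 if ruin never occurs.\<close>

definition discount :: "real \<Rightarrow> 'a \<Rightarrow> real" where
  "discount q \<omega> = (if \<tau> \<omega> = \<infinity> then 0 else exp (- q * (real_of_ereal (\<tau> \<omega>) - t)))"

lemma discount_measurable: "discount q \<in> borel_measurable M"
  unfolding discount_def using ruin_time_measurable by measurable

lemma discount_bounds:
  assumes "q > 0"
  shows "0 \<le> discount q \<omega>" "discount q \<omega> \<le> 1"
  using assms ruin_time_ge[of \<omega>] by (cases "\<tau> \<omega>"; simp add: discount_def)+

lemma discount_integrable: "q > 0 \<Longrightarrow> integrable M (discount q)"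
  using discount_bounds discount_measurable
  by (intro integrable_const_bound[of _ 1]) (auto simp: abs_le_iff intro: order_trans[of _ 0])

lemma exp_mart_stopped:
  assumes "t \<le> w"
  shows "integrable M (\<lambda>\<omega>. (exp_mart c t (stopped w \<omega>) \<omega>)\<^sup>2)"
    and "integrable M (\<lambda>\<omega>. exp_mart c t (stopped w \<omega>) \<omega>)"
    and "(\<integral>\<omega>. exp_mart c t (stopped w \<omega>) \<omega> \<partial>M) = 1"
proof -
  have \<rho>: "t \<le> stopped w \<omega> \<and> stopped w \<omega> \<le> w" for \<omega> using stopped_props[OF assms] by blast
  note os = exp_mart_optional_stopping[OF t_nonneg order_refl \<rho> stopped_event[OF assms] stopped_measurable]
  show sq: "integrable M (\<lambda>\<omega>. (exp_mart c t (stopped w \<omega>) \<omega>)\<^sup>2)" by (rule os(1))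
  show "integrable M (\<lambda>\<omega>. exp_mart c t (stopped w \<omega>) \<omega>)"
    by (rule square_integrable_imp_integrable[OF exp_mart_stopped_measurable[OF assms] sq])
  have "(\<integral>\<omega>. 1 * exp_mart c t (stopped w \<omega>) \<omega> \<partial>M) = (\<integral>\<omega>. 1 * exp_mart c t t \<omega> \<partial>M)"
    by (rule os(2)[where K = 1]) simp_all
  then show "(\<integral>\<omega>. exp_mart c t (stopped w \<omega>) \<omega> \<partial>M) = 1" by (simp add: exp_mart_def prob_space)
qed

text \<open>Since the stopped martingale has mean 1, its \<open>L\<^sup>1\<close> distance from 1 is at most its standard deviation.\<close>

lemma exp_mart_stopped_L1_dist:
  assumes "t \<le> w"
  shows "(\<integral>\<omega>. \<bar>exp_mart c t (stopped w \<omega>) \<omega> - 1\<bar> \<partial>M) \<le> sqrt (exp (c\<^sup>2 * (w - t)) - 1)"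
proof (rule real_le_rsqrt)
  let ?Z = "\<lambda>\<omega>. exp_mart c t (stopped w \<omega>) \<omega>"
  have sq: "(?Z \<omega> - 1)\<^sup>2 = (?Z \<omega>)\<^sup>2 - 2 * ?Z \<omega> + 1" for \<omega>
    by (simp add: power2_eq_square algebra_simps)
  note E = exp_mart_stopped[OF assms]
  have int: "integrable M (\<lambda>\<omega>. (?Z \<omega> - 1)\<^sup>2)" unfolding sq using E by simp
  have "(\<integral>\<omega>. \<bar>?Z \<omega> - 1\<bar> \<partial>M)\<^sup>2 \<le> (\<integral>\<omega>. \<bar>?Z \<omega> - 1\<bar>\<^sup>2 \<partial>M)"
  proof -
    have i: "integrable M (\<lambda>\<omega>. \<bar>?Z \<omega> - 1\<bar>)" using E(2) by simp
    have i2: "integrable M (\<lambda>\<omega>. \<bar>?Z \<omega> - 1\<bar>\<^sup>2)" using int by simp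
    show ?thesis using variance_eq[OF i i2] variance_positive[of "\<lambda>\<omega>. \<bar>?Z \<omega> - 1\<bar>"] by linarith
  qed
  also have "\<dots> = (\<integral>\<omega>. (?Z \<omega>)\<^sup>2 \<partial>M) - 1"
    unfolding power2_abs sq using E by (simp add: prob_space)
  also have "(\<integral>\<omega>. (?Z \<omega>)\<^sup>2 \<partial>M) \<le> (\<integral>\<omega>. exp (c\<^sup>2 * (w - t)) * exp_mart (2 * c) t (stopped w \<omega>) \<omega> \<partial>M)"
  proof (rule integral_mono[OF E(1)])
    show "integrable M (\<lambda>\<omega>. exp (c\<^sup>2 * (w - t)) * exp_mart (2 * c) t (stopped w \<omega>) \<omega>)"
      using exp_mart_stopped(2)[OF assms] by simp
    show "(?Z \<omega>)\<^sup>2 \<le> exp (c\<^sup>2 * (w - t)) * exp_mart (2 * c) t (stopped w \<omega>) \<omega>" for \<omega>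
      unfolding exp_mart_square using stopped_props(2)[OF assms, of \<omega>] exp_mart_pos[of "2 * c" t "stopped w \<omega>" \<omega>]
      by (intro mult_right_mono) (auto intro!: mult_left_mono)
  qed
  also have "(\<integral>\<omega>. exp (c\<^sup>2 * (w - t)) * exp_mart (2 * c) t (stopped w \<omega>) \<omega> \<partial>M) = exp (c\<^sup>2 * (w - t))"
    using exp_mart_stopped(3)[OF assms, of "2 * c"] by simp
  finally show "(\<integral>\<omega>. \<bar>?Z \<omega> - 1\<bar> \<partial>M)\<^sup>2 \<le> exp (c\<^sup>2 * (w - t)) - 1" by simp
qed

text \<open>A factor \<open>\<xi>\<close> that is known at time \<open>a\<close>, as long as ruin has not yet occurred, does not see the
  evolution of the exponential martingale after \<open>a\<close>.\<close>

lemma exp_mart_stopped_later: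
  assumes "t \<le> a" "a \<le> w"
    and \<xi>: "\<xi> \<in> borel_measurable M" "\<And>\<omega>. \<omega> \<in> space M \<Longrightarrow> \<bar>\<xi> \<omega>\<bar> \<le> K"
    and \<xi>F: "(\<lambda>\<omega>. indicator {\<omega>\<in>space M. ereal a < \<tau> \<omega>} \<omega> * \<xi> \<omega>) \<in> borel_measurable (F a)"
  shows "(\<integral>\<omega>. \<xi> \<omega> * exp_mart c t (stopped w \<omega>) \<omega> \<partial>M) = (\<integral>\<omega>. \<xi> \<omega> * exp_mart c t (stopped a \<omega>) \<omega> \<partial>M)"
proof -
  have "t \<le> w" "0 \<le> a" using assms t_nonneg by auto
  define \<eta> where "\<eta> \<omega> = indicator {\<omega>\<in>space M. ereal a < \<tau> \<omega>} \<omega> * \<xi> \<omega>" for \<omega>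
  define \<rho> where "\<rho> \<omega> = max a (stopped w \<omega>)" for \<omega>
  have \<rho>: "a \<le> \<rho> \<omega> \<and> \<rho> \<omega> \<le> w" for \<omega>
    using stopped_props[OF \<open>t \<le> w\<close>, of \<omega>] assms by (auto simp: \<rho>_def)
  have \<rho>M: "\<rho> \<in> borel_measurable M" unfolding \<rho>_def using stopped_measurable by measurable
  have \<rho>_stop: "{\<omega>\<in>space M. \<rho> \<omega> \<le> s} \<in> sets (F s)" if "a \<le> s" for s
    using stopped_event[OF \<open>t \<le> w\<close>, of s] that assms(1) by (simp add: \<rho>_def)
  have \<eta>: "\<eta> \<in> borel_measurable (F a)" unfolding \<eta>_def by (rule \<xi>F)
  have \<eta>K: "\<bar>\<eta> \<omega>\<bar> \<le> K" if "\<omega> \<in> space M" for \<omega>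
    using \<xi>(2)[OF that] by (auto simp: \<eta>_def indicator_def)
  have int: "integrable M (\<lambda>\<omega>. f \<omega> * z \<omega>)"
    if "integrable M z" "f \<in> borel_measurable M" "\<And>\<omega>. \<omega> \<in> space M \<Longrightarrow> \<bar>f \<omega>\<bar> \<le> K" for f z :: "'a \<Rightarrow> real"
  proof (rule Bochner_Integration.integrable_bound[of M "\<lambda>\<omega>. K * z \<omega>"])
    show "AE \<omega> in M. norm (f \<omega> * z \<omega>) \<le> norm (K * z \<omega>)"
    proof (rule AE_I2)
      fix \<omega> assume "\<omega> \<in> space M"
      then have "\<bar>f \<omega>\<bar> \<le> \<bar>K\<bar>" using that(3) abs_ge_self order_trans by blast
      then show "norm (f \<omega> * z \<omega>) \<le> norm (K * z \<omega>)" by (simp add: abs_mult mult_right_mono)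
    qed
  qed (use that in simp_all)
  have eq: "\<xi> \<omega> * exp_mart c t (stopped w \<omega>) \<omega> - \<xi> \<omega> * exp_mart c t (stopped a \<omega>) \<omega> =
      \<eta> \<omega> * exp_mart c t (\<rho> \<omega>) \<omega> - \<eta> \<omega> * exp_mart c t a \<omega>" if "\<omega> \<in> space M" for \<omega>
  proof (cases "ereal a < \<tau> \<omega>")
    case True
    then have "stopped a \<omega> = a" "\<eta> \<omega> = \<xi> \<omega>"
      using that by (auto simp: \<eta>_def intro!: stopped_before)
    moreover have "\<rho> \<omega> = stopped w \<omega>"
      using True assms(2) by (cases "\<tau> \<omega>") (auto simp: \<rho>_def stopped_def min_def max_def)
    ultimately show ?thesis by simp
  next
    case False
    then have "stopped w \<omega> = stopped a \<omega>"
      using assms(1,2) ruin_time_ge[of \<omega>] by (cases "\<tau> \<omega>") (auto simp: stopped_def min_def)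
    moreover have "\<eta> \<omega> = 0" using False by (simp add: \<eta>_def)
    ultimately show ?thesis by simp
  qed
  have \<eta>M: "\<eta> \<in> borel_measurable M" using \<eta> \<open>0 \<le> a\<close> by (rule measurable_F_M)
  have sqr: "integrable M (\<lambda>\<omega>. exp_mart c t (\<rho> \<omega>) \<omega>)"
    by (rule square_integrable_imp_integrable[OF exp_mart_at_measurable[OF t_nonneg \<rho>M]
          exp_mart_optional_stopping(1)[OF t_nonneg assms(1) \<rho> \<rho>_stop \<rho>M]])
      (use \<rho> assms(1) order_trans in blast)
  note i1 = int[OF exp_mart_stopped(2)[OF \<open>t \<le> w\<close>, of c] \<xi>]
  note i2 = int[OF exp_mart_stopped(2)[OF \<open>t \<le> a\<close>, of c] \<xi>]
  note i3 = int[OF sqr \<eta>M \<eta>K]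
  note i4 = int[OF exp_mart_integrable[OF t_nonneg \<open>t \<le> a\<close>, of c] \<eta>M \<eta>K]
  have "(\<integral>\<omega>. \<xi> \<omega> * exp_mart c t (stopped w \<omega>) \<omega> - \<xi> \<omega> * exp_mart c t (stopped a \<omega>) \<omega> \<partial>M) =
      (\<integral>\<omega>. \<eta> \<omega> * exp_mart c t (\<rho> \<omega>) \<omega> - \<eta> \<omega> * exp_mart c t a \<omega> \<partial>M)"
    by (rule Bochner_Integration.integral_cong[OF refl eq])
  also have "\<dots> = (\<integral>\<omega>. \<eta> \<omega> * exp_mart c t (\<rho> \<omega>) \<omega> \<partial>M) - (\<integral>\<omega>. \<eta> \<omega> * exp_mart c t a \<omega> \<partial>M)"
    by (rule Bochner_Integration.integral_diff[OF i3 i4])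
  also have "\<dots> = 0"
    using exp_mart_optional_stopping(2)[OF t_nonneg assms(1) \<rho> \<rho>_stop \<rho>M \<eta> \<eta>K, of c] by simp
  finally show ?thesis using Bochner_Integration.integral_diff[OF i1 i2] by simp
qed

end

section \<open>Discounted ruin under a small perturbation of the drift\<close>

text \<open>The deviation of \<open>Y\<close> from the Brownian motion \<open>x + m (s - t) + \<sigma> (W\<^sub>s - W\<^sub>t)\<close> with constant drift.\<close>

definition excess ::
    "real \<Rightarrow> real \<Rightarrow> (real \<Rightarrow> 'a \<Rightarrow> real) \<Rightarrow> real \<Rightarrow> real \<Rightarrow> (real \<Rightarrow> 'a \<Rightarrow> real) \<Rightarrow> real \<Rightarrow> 'a \<Rightarrow> real" where
  "excess m \<sigma> W t x Y s \<omega> = Y s \<omega> - x - m * (s - t) - \<sigma> * (W s \<omega> - W t \<omega>)"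

text \<open>A process that, up to its ruin time, is a Brownian motion with drift \<open>m\<close> plus an excess which takes
  values in \<open>[0, K]\<close> and is constant from time \<open>a\<close> on. In the application \<open>m = \<mu> - L\<close>, and the excess
  comes from paying less than the maximal rate \<open>L\<close> before time \<open>a\<close>.\<close>

locale perturbed_ruin = continuous_adapted M F W t Y
  for M :: "'a measure" and F :: "real \<Rightarrow> 'a measure" and W :: "real \<Rightarrow> 'a \<Rightarrow> real"
    and t :: real and Y :: "real \<Rightarrow> 'a \<Rightarrow> real" +
  fixes x m \<sigma> a K :: real
  assumes x_nonneg: "0 \<le> x" and t_le_a: "t \<le> a" and K_nonneg: "0 \<le> K"
    and dynamics: "AE \<omega> in M. Y t \<omega> = x \<and>
      (\<forall>s\<ge>t. ereal s \<le> ruin_time t Y \<omega> \<longrightarrow>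
        0 \<le> excess m \<sigma> W t x Y s \<omega> \<and> excess m \<sigma> W t x Y s \<omega> \<le> K) \<and>
      (\<forall>s\<ge>a. ereal s \<le> ruin_time t Y \<omega> \<longrightarrow> excess m \<sigma> W t x Y s \<omega> = excess m \<sigma> W t x Y a \<omega>)"
begin

abbreviation G :: "real \<Rightarrow> 'a \<Rightarrow> real" where
  "G \<equiv> excess m \<sigma> W t x Y"

text \<open>The excess at time \<open>min a \<tau>\<close>, which almost surely is also the excess at all later times up to ruin.
  It is truncated to \<open>[0, K]\<close> so that its bounds hold everywhere.\<close>

definition total_excess :: "'a \<Rightarrow> real" where
  "total_excess \<omega> = max 0 (min K (G (stopped a \<omega>) \<omega>))"

lemma total_excess_bounds: "0 \<le> total_excess \<omega>" "total_excess \<omega> \<le> K"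
  using K_nonneg by (auto simp: total_excess_def)

lemma G_measurable_F:
  assumes "t \<le> s"
  shows "G s \<in> borel_measurable (F s)"
proof -
  have [measurable]: "Y s \<in> borel_measurable (F s)" "W s \<in> borel_measurable (F s)"
      "W t \<in> borel_measurable (F s)"
    using Y_adapted[OF assms] W_measurable_F[of s s] W_measurable_F[of t s] t_nonneg assms by auto
  show ?thesis unfolding excess_def by measurable
qed

lemma total_excess_measurable: "total_excess \<in> borel_measurable M"
proof -
  have "(\<lambda>\<omega>. G (stopped a \<omega>) \<omega>) \<in> borel_measurable M"
  proof (rule at_stopped_measurable[OF t_le_a])
    show "G s \<in> borel_measurable M" if "t \<le> s" for s
      using measurable_F_M[OF G_measurable_F[OF that]] that t_nonneg by simp
    show "continuous_on {t..} (\<lambda>s. G s \<omega>)" if "\<omega> \<in> space M" for \<omega>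
      unfolding excess_def
      by (intro continuous_intros Y_continuous[OF that] continuous_on_subset[OF W_continuous[OF that]])
        (use t_nonneg in auto)
  qed
  then show ?thesis unfolding total_excess_def by measurable
qed

lemma total_excess_integrable: "integrable M total_excess"
  using total_excess_bounds total_excess_measurable
  by (intro integrable_const_bound[of _ K]) auto

lemma total_excess_known_at_a:
  "(\<lambda>\<omega>. indicator {\<omega>\<in>space M. ereal a < \<tau> \<omega>} \<omega> * total_excess \<omega>) \<in> borel_measurable (F a)"
proof -
  have eq: "indicator {\<omega>\<in>space M. ereal a < \<tau> \<omega>} \<omega> * total_excess \<omega> =
      indicator {\<omega>\<in>space M. ereal a < \<tau> \<omega>} \<omega> * max 0 (min K (G a \<omega>))" for \<omega>
  proof (cases "ereal a < \<tau> \<omega>")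
    case True
    then have "stopped a \<omega> = a" by (intro stopped_before) simp
    then show ?thesis by (simp add: total_excess_def)
  qed simp
  note [measurable] = survival_event[OF t_le_a]
  have [measurable]: "G a \<in> borel_measurable (F a)" by (rule G_measurable_F[OF t_le_a])
  show ?thesis unfolding eq by measurable
qed

lemma AE_dynamics:
  "AE \<omega> in M. \<omega> \<in> space M \<and> Y t \<omega> = x \<and>
    (\<forall>w\<ge>a. G (stopped w \<omega>) \<omega> = total_excess \<omega>) \<and>
    (\<forall>w\<ge>t. 0 \<le> Y (stopped w \<omega>) \<omega>) \<and> (\<forall>T. \<tau> \<omega> = ereal T \<longrightarrow> Y T \<omega> = 0)"
  using dynamics AE_space
proof eventually_elim
  case (elim \<omega>)
  have G: "0 \<le> G s \<omega>" "G s \<omega> \<le> K" if "t \<le> s" "ereal s \<le> \<tau> \<omega>" for s using elim that by blast+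
  have tot: "G (stopped a \<omega>) \<omega> = total_excess \<omega>"
    using G[OF stopped_props(1,3)[OF t_le_a]] by (simp add: total_excess_def)
  have Ga: "G (stopped w \<omega>) \<omega> = total_excess \<omega>" if "a \<le> w" for w
  proof (cases "ereal a \<le> \<tau> \<omega>")
    case True
    then have "a \<le> stopped w \<omega>" using that by (cases "\<tau> \<omega>") (auto simp: stopped_def min_def)
    then have "G (stopped w \<omega>) \<omega> = G a \<omega>"
      using elim stopped_props(3)[OF order_trans[OF t_le_a that]] by blast
    then show ?thesis using tot stopped_before[OF True] by simp
  next
    case False
    then have "stopped w \<omega> = stopped a \<omega>"
      using that ruin_time_ge[of \<omega>] by (cases "\<tau> \<omega>") (auto simp: stopped_def min_def)
    then show ?thesis using tot by simp
  qed
  have Y0: "Y T \<omega> = 0" if T: "\<tau> \<omega> = ereal T" for T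
  proof -
    have "t \<le> T" "Y T \<omega> \<le> 0"
      using T elim(2) by (auto elim!: ruin_time_cases)
    moreover have "0 \<le> Y T \<omega>"
    proof (rule ccontr)
      assume neg: "\<not> 0 \<le> Y T \<omega>"
      have "0 \<le> Y t \<omega>" using elim x_nonneg by simp
      have "continuous_on {t..T} (\<lambda>s. Y s \<omega>)"
        using Y_continuous[OF elim(2)] by (rule continuous_on_subset) auto
      then obtain s where "t \<le> s" "s \<le> T" "Y s \<omega> = 0"
        using IVT2'[of "\<lambda>s. Y s \<omega>" T 0 t] \<open>t \<le> T\<close> neg \<open>0 \<le> Y t \<omega>\<close> by auto
      moreover from this have "s < T" using neg by (cases "s = T") auto
      ultimately show False using positive_before_ruin[of s \<omega>] T by simp
    qed
    ultimately show ?thesis by simp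
  qed
  have "0 \<le> Y (stopped w \<omega>) \<omega>" if "t \<le> w" for w
  proof (cases "ereal w < \<tau> \<omega>")
    case True
    then show ?thesis using positive_before_ruin[OF that True] stopped_before[of w \<omega>] by simp
  next
    case False
    then obtain T where T: "\<tau> \<omega> = ereal T" "T \<le> w"
      using ruin_time_ge[of \<omega>] by (cases "\<tau> \<omega>") auto
    then show ?thesis using Y0 stopped_after[OF T] by simp
  qed
  then show ?case using elim Ga Y0 by blast
qed

text \<open>If \<open>b < 0\<close> solves the characteristic equation, then \<open>exp (b Y\<^sub>s - q (s - t))\<close> agrees with an
  exponential martingale up to the factor \<open>exp (b x + b G\<^sub>s)\<close>. At ruin \<open>Y\<close> vanishes, so that the
  martingale turns into the discount factor.\<close>

lemma exp_mart_stopped_eq: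
  assumes char: "\<sigma>\<^sup>2 / 2 * b\<^sup>2 + m * b = q"
  shows "exp_mart (b * \<sigma>) t s \<omega> =
    exp (- b * x) * (exp (- q * (s - t)) * exp (b * Y s \<omega>) * exp (- b * G s \<omega>))"
proof -
  have "b * \<sigma> * (W s \<omega> - W t \<omega>) - (b * \<sigma>)\<^sup>2 * (s - t) / 2 =
      - b * x + (- q * (s - t) + b * Y s \<omega> + - b * G s \<omega>)"
    unfolding excess_def char[symmetric] by (simp add: power2_eq_square field_simps)
  then show ?thesis unfolding exp_mart_def by (simp only: exp_add)
qed

text \<open>On survival up to \<open>w\<close>, the process \<open>exp (b Y\<^sub>w - q (w - t))\<close> is at most \<open>exp (- q (w - t))\<close> and tends
  to 0, which matches the value 0 of the discount factor at infinite ruin time. The stopped martingale is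
  bounded, so that optional stopping extends from the times \<open>min w \<tau>\<close> to \<open>\<tau>\<close>.\<close>

lemma discount_identity:
  assumes "q > 0" "b < 0" and char: "\<sigma>\<^sup>2 / 2 * b\<^sup>2 + m * b = q"
    and \<xi>: "\<xi> \<in> borel_measurable M" "\<And>\<omega>. \<omega> \<in> space M \<Longrightarrow> \<bar>\<xi> \<omega>\<bar> \<le> B"
    and \<xi>F: "(\<lambda>\<omega>. indicator {\<omega>\<in>space M. ereal a < \<tau> \<omega>} \<omega> * \<xi> \<omega>) \<in> borel_measurable (F a)"
  shows "(\<integral>\<omega>. \<xi> \<omega> * (discount q \<omega> * exp (- b * total_excess \<omega>)) \<partial>M) =
    exp (b * x) * (\<integral>\<omega>. \<xi> \<omega> * exp_mart (b * \<sigma>) t (stopped a \<omega>) \<omega> \<partial>M)"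
proof -
  let ?Z = "\<lambda>n \<omega>. exp_mart (b * \<sigma>) t (stopped (a + real n) \<omega>) \<omega>"
  let ?R = "\<lambda>\<omega>. exp (- b * x) * (discount q \<omega> * exp (- b * total_excess \<omega>))"
  have ta: "t \<le> a + real n" for n using t_le_a by simp
  have Z_eq: "AE \<omega> in M. \<forall>n. ?Z n \<omega> = exp (- b * x) * (exp (- q * (stopped (a + real n) \<omega> - t)) *
      exp (b * Y (stopped (a + real n) \<omega>) \<omega>) * exp (- b * total_excess \<omega>))"
    using AE_dynamics by eventually_elim (simp add: exp_mart_stopped_eq[OF char])
  have bound: "AE \<omega> in M. \<forall>n. norm (\<xi> \<omega> * ?Z n \<omega>) \<le> B * (exp (- b * x) * exp (- b * K))"
    using Z_eq AE_dynamics
  proof eventually_elim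
    case (elim \<omega>)
    show ?case
    proof
      fix n
      have "exp (- q * (stopped (a + real n) \<omega> - t)) \<le> 1"
        using assms(1) stopped_props(1)[OF ta, of n \<omega>] by simp
      moreover have "exp (b * Y (stopped (a + real n) \<omega>) \<omega>) \<le> 1"
        using assms(2) elim(2) ta[of n] by (simp add: mult_nonpos_nonneg)
      moreover have "exp (- b * total_excess \<omega>) \<le> exp (- b * K)"
        using assms(2) total_excess_bounds(2)[of \<omega>] by simp
      ultimately have "exp (- q * (stopped (a + real n) \<omega> - t)) * exp (b * Y (stopped (a + real n) \<omega>) \<omega>) *
          exp (- b * total_excess \<omega>) \<le> 1 * 1 * exp (- b * K)"
        by (intro mult_mono) auto
      then have "?Z n \<omega> \<le> exp (- b * x) * exp (- b * K)" using elim(1) by simp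
      moreover have "\<bar>\<xi> \<omega>\<bar> \<le> B" using \<xi>(2) elim(2) by blast
      ultimately show "norm (\<xi> \<omega> * ?Z n \<omega>) \<le> B * (exp (- b * x) * exp (- b * K))"
        using exp_mart_pos[of "b * \<sigma>" t "stopped (a + real n) \<omega>" \<omega>] unfolding real_norm_def abs_mult abs_of_pos[OF exp_mart_pos]
        by (intro mult_mono) auto
    qed
  qed
  have lim: "AE \<omega> in M. (\<lambda>n. \<xi> \<omega> * ?Z n \<omega>) \<longlonglongrightarrow> \<xi> \<omega> * ?R \<omega>"
    using Z_eq AE_dynamics
  proof eventually_elim
    case (elim \<omega>)
    let ?D = "\<lambda>n. exp (- q * (stopped (a + real n) \<omega> - t)) * exp (b * Y (stopped (a + real n) \<omega>) \<omega>)"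
    have "?D \<longlonglongrightarrow> discount q \<omega>"
    proof (cases "\<tau> \<omega>" rule: ereal_cases)
      case (real T)
      obtain N :: nat where "T - a \<le> real N" using real_arch_simple by blast
      have "?D n = discount q \<omega>" if "n \<ge> N" for n
      proof -
        have "T \<le> a + real n" using \<open>T - a \<le> real N\<close> that by linarith
        then have "stopped (a + real n) \<omega> = T" by (rule stopped_after[OF real])
        then show ?thesis using elim(2) real by (simp add: discount_def)
      qed
      then show ?thesis
        by (intro tendsto_eventually eventually_sequentiallyI[of N])
    next
      case PInf
      have "filterlim (\<lambda>n. a + real n) at_top sequentially"
        by (intro filterlim_tendsto_add_at_top[OF tendsto_const] filterlim_real_sequentially)
      then have lim0: "(\<lambda>n. exp (- q * (a + real n - t))) \<longlonglongrightarrow> 0"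
        by (rule filterlim_compose[OF exp_neg_tendsto_0[OF assms(1)]])
      have st: "stopped (a + real n) \<omega> = a + real n" for n using PInf by (intro stopped_before) simp
      have "?D n \<le> exp (- q * (a + real n - t))" for n
      proof -
        have "exp (b * Y (stopped (a + real n) \<omega>) \<omega>) \<le> 1"
          using assms(2) elim(2) ta[of n] by (simp add: mult_nonpos_nonneg)
        then show ?thesis unfolding st by (simp add: mult_left_le)
      qed
      then have "?D \<longlonglongrightarrow> 0"
        by (intro tendsto_sandwich[OF _ _ tendsto_const lim0] always_eventually allI) simp_all
      then show ?thesis using PInf by (simp add: discount_def)
    next
      case MInf
      then show ?thesis using ruin_time_ge[of \<omega>] by simp
    qed
    then show ?case using elim(1) by (auto intro!: tendsto_intros)
  qed
  have R_meas: "(\<lambda>\<omega>. \<xi> \<omega> * ?R \<omega>) \<in> borel_measurable M"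
    using \<xi>(1) discount_measurable total_excess_measurable by measurable
  have Z_meas: "(\<lambda>\<omega>. \<xi> \<omega> * ?Z n \<omega>) \<in> borel_measurable M" for n
    using \<xi>(1) exp_mart_stopped_measurable[OF ta] by measurable
  have "(\<lambda>n. \<integral>\<omega>. \<xi> \<omega> * ?Z n \<omega> \<partial>M) \<longlonglongrightarrow> (\<integral>\<omega>. \<xi> \<omega> * ?R \<omega> \<partial>M)"
    by (rule integral_dominated_convergence[OF R_meas Z_meas _ lim, where w = "\<lambda>_. B * (exp (- b * x) * exp (- b * K))"])
      (use bound in \<open>auto simp only: integrable_const AE_all_countable\<close>)
  moreover have "(\<integral>\<omega>. \<xi> \<omega> * ?Z n \<omega> \<partial>M) = (\<integral>\<omega>. \<xi> \<omega> * exp_mart (b * \<sigma>) t (stopped a \<omega>) \<omega> \<partial>M)" for n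
    by (rule exp_mart_stopped_later[OF t_le_a _ \<xi> \<xi>F]) simp_all
  ultimately have "(\<integral>\<omega>. \<xi> \<omega> * ?R \<omega> \<partial>M) = (\<integral>\<omega>. \<xi> \<omega> * exp_mart (b * \<sigma>) t (stopped a \<omega>) \<omega> \<partial>M)"
    by (simp only: LIMSEQ_const_iff)
  moreover have "(\<integral>\<omega>. \<xi> \<omega> * ?R \<omega> \<partial>M) =
      exp (- b * x) * (\<integral>\<omega>. \<xi> \<omega> * (discount q \<omega> * exp (- b * total_excess \<omega>)) \<partial>M)"
    by (subst integral_mult_right_zero[symmetric]) (simp add: mult.left_commute)
  ultimately show ?thesis by (simp add: exp_minus field_simps)
qed

text \<open>The Laplace transform of the ruin time, with the effect of the excess compensated. Without excess the
  discount factor has mean \<open>exp (b x)\<close>.\<close>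

lemma expectation_discount_compensated:
  assumes "q > 0" "b < 0" and char: "\<sigma>\<^sup>2 / 2 * b\<^sup>2 + m * b = q"
  shows "(\<integral>\<omega>. discount q \<omega> * exp (- b * total_excess \<omega>) \<partial>M) = exp (b * x)"
proof -
  note [measurable] = survival_event[OF t_le_a]
  show ?thesis
    using discount_identity[OF assms, of "\<lambda>_. 1" 1] exp_mart_stopped(3)[OF t_le_a] by simp
qed

text \<open>A lower bound with the linearisation of \<open>exp (b d)\<close> in the total excess \<open>d\<close>, by convexity. The
  error term comes from replacing the martingale at time \<open>min a \<tau>\<close> by 1, which costs only
  \<open>O(sqrt (a - t))\<close>.\<close>

lemma expectation_discount_ge:
  assumes "q > 0" "b < 0" and char: "\<sigma>\<^sup>2 / 2 * b\<^sup>2 + m * b = q"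
  shows "exp (b * x) * (1 + b * (\<integral>\<omega>. total_excess \<omega> \<partial>M) + b * (K * sqrt (exp ((b * \<sigma>)\<^sup>2 * (a - t)) - 1)))
    \<le> (\<integral>\<omega>. discount q \<omega> \<partial>M)"
proof -
  let ?d = total_excess and ?Z = "\<lambda>\<omega>. exp_mart (b * \<sigma>) t (stopped a \<omega>) \<omega>"
  let ?P = "\<lambda>\<omega>. discount q \<omega> * exp (- b * ?d \<omega>)"
  have d: "\<bar>?d \<omega>\<bar> \<le> K" for \<omega> using total_excess_bounds[of \<omega>] by simp
  have intd: "integrable M (\<lambda>\<omega>. ?d \<omega> * z \<omega>)" if "integrable M z" for z
    by (rule Bochner_Integration.integrable_bound[of M "\<lambda>\<omega>. K * z \<omega>"])
      (use that d K_nonneg total_excess_measurable in \<open>auto simp: abs_mult intro!: mult_right_mono\<close>)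
  have intP: "integrable M ?P"
  proof (rule integrable_const_bound[of _ "exp (- b * K)"])
    have "?P \<omega> \<le> 1 * exp (- b * K)" for \<omega>
      using assms(2) total_excess_bounds(2)[of \<omega>] discount_bounds[OF assms(1)]
      by (intro mult_mono) auto
    then show "AE \<omega> in M. norm (?P \<omega>) \<le> exp (- b * K)"
      using discount_bounds[OF assms(1)] by (simp add: abs_mult)
  qed (use discount_measurable total_excess_measurable in measurable)
  have E: "(\<integral>\<omega>. ?d \<omega> * ?P \<omega> \<partial>M) = exp (b * x) * (\<integral>\<omega>. ?d \<omega> * ?Z \<omega> \<partial>M)"
    by (rule discount_identity[OF assms total_excess_measurable d total_excess_known_at_a])
  have "(\<integral>\<omega>. ?d \<omega> * ?Z \<omega> \<partial>M) \<le> (\<integral>\<omega>. ?d \<omega> + K * \<bar>?Z \<omega> - 1\<bar> \<partial>M)"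
  proof (rule integral_mono)
    show "integrable M (\<lambda>\<omega>. ?d \<omega> * ?Z \<omega>)" by (rule intd[OF exp_mart_stopped(2)[OF t_le_a]])
    show "integrable M (\<lambda>\<omega>. ?d \<omega> + K * \<bar>?Z \<omega> - 1\<bar>)"
      using total_excess_integrable exp_mart_stopped(2)[OF t_le_a] by simp
    fix \<omega>
    have "?d \<omega> * (?Z \<omega> - 1) \<le> K * \<bar>?Z \<omega> - 1\<bar>"
      using mult_left_mono[OF abs_ge_self total_excess_bounds(1), of \<omega> "?Z \<omega> - 1"]
        mult_right_mono[OF total_excess_bounds(2), of "\<bar>?Z \<omega> - 1\<bar>" \<omega>] by linarith
    then show "?d \<omega> * ?Z \<omega> \<le> ?d \<omega> + K * \<bar>?Z \<omega> - 1\<bar>" by (simp add: algebra_simps)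
  qed
  also have "\<dots> = (\<integral>\<omega>. ?d \<omega> \<partial>M) + K * (\<integral>\<omega>. \<bar>?Z \<omega> - 1\<bar> \<partial>M)"
    using total_excess_integrable exp_mart_stopped(2)[OF t_le_a] by simp
  also have "\<dots> \<le> (\<integral>\<omega>. ?d \<omega> \<partial>M) + K * sqrt (exp ((b * \<sigma>)\<^sup>2 * (a - t)) - 1)"
    using exp_mart_stopped_L1_dist[OF t_le_a] K_nonneg by (intro add_left_mono mult_left_mono)
  finally have dZ: "b * (\<integral>\<omega>. ?d \<omega> * ?Z \<omega> \<partial>M) \<ge>
      b * ((\<integral>\<omega>. ?d \<omega> \<partial>M) + K * sqrt (exp ((b * \<sigma>)\<^sup>2 * (a - t)) - 1))"
    using assms(2) by (intro mult_left_mono_neg) auto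
  have "exp (b * x) * (1 + b * (\<integral>\<omega>. ?d \<omega> \<partial>M) + b * (K * sqrt (exp ((b * \<sigma>)\<^sup>2 * (a - t)) - 1)))
      \<le> exp (b * x) * (1 + b * (\<integral>\<omega>. ?d \<omega> * ?Z \<omega> \<partial>M))"
    using dZ by (intro mult_left_mono) (auto simp: algebra_simps)
  also have "\<dots> = (\<integral>\<omega>. ?P \<omega> \<partial>M) + b * (\<integral>\<omega>. ?d \<omega> * ?P \<omega> \<partial>M)"
    unfolding E expectation_discount_compensated[OF assms] by (simp add: algebra_simps)
  also have "\<dots> = (\<integral>\<omega>. ?P \<omega> + b * (?d \<omega> * ?P \<omega>) \<partial>M)"
    using intP intd[OF intP] by simp
  also have "\<dots> \<le> (\<integral>\<omega>. discount q \<omega> \<partial>M)"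
  proof (rule integral_mono)
    show "integrable M (\<lambda>\<omega>. ?P \<omega> + b * (?d \<omega> * ?P \<omega>))" using intP intd[OF intP] by simp
    show "integrable M (discount q)" by (rule discount_integrable[OF assms(1)])
    fix \<omega>
    have "?P \<omega> + b * (?d \<omega> * ?P \<omega>) = ?P \<omega> * (1 + b * ?d \<omega>)" by (simp add: algebra_simps)
    also have "\<dots> \<le> ?P \<omega> * exp (b * ?d \<omega>)"
      using exp_ge_add_one_self discount_bounds[OF assms(1)] by (intro mult_left_mono) auto
    also have "\<dots> = discount q \<omega>" by (simp add: exp_minus field_simps)
    finally show "?P \<omega> + b * (?d \<omega> * ?P \<omega>) \<le> discount q \<omega>" .
  qed
  finally show ?thesis .
qed

end

section \<open>The reward of a control that is eventually maximal\<close>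

lemma discounted_annuity:
  fixes t \<delta> :: real and T :: ereal
  assumes "\<delta> > 0" "ereal t \<le> T"
  defines "D \<equiv> if T = \<infinity> then 0 else exp (- \<delta> * (real_of_ereal T - t))"
  shows "set_integrable lborel (einterval (ereal t) T) (\<lambda>s. exp (- \<delta> * (s - t)))"
    and "(LBINT s=ereal t..T. exp (- \<delta> * (s - t))) = (1 - D) / \<delta>"
proof -
  have "set_integrable lborel (einterval (ereal t) T) (\<lambda>s. exp (- \<delta> * (s - t))) \<and>
    (LBINT s=ereal t..T. exp (- \<delta> * (s - t))) = (1 - D) / \<delta>"
  proof (cases "T = ereal t")
    case True
    then have "D = 1" by (simp add: D_def)
    then show ?thesis using True by (simp add: set_integrable_def einterval_same interval_integral_endpoints_same)
  next
    case False
    then have less: "ereal t < T" using assms(2) by simp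
    let ?H = "\<lambda>s. - exp (- \<delta> * (s - t)) / \<delta>"
    have der: "(?H has_real_derivative exp (- \<delta> * (s - t))) (at s)" for s
      using assms(1) by (auto intro!: derivative_eq_intros)
    have cont: "isCont ?H s" for s by (rule DERIV_isCont[OF der])
    have A: "((?H \<circ> real_of_ereal) \<longlongrightarrow> - 1 / \<delta>) (at_right (ereal t))"
    proof -
      have "(?H \<longlongrightarrow> ?H t) (at_right t)" using cont[of t] by (simp add: isCont_def filterlim_at_split)
      then show ?thesis unfolding ereal_tendsto_simps by simp
    qed
    have B: "((?H \<circ> real_of_ereal) \<longlongrightarrow> - D / \<delta>) (at_left T)"
    proof (cases T)
      case (real r)
      have "(?H \<longlongrightarrow> ?H r) (at_left r)" using cont[of r] by (simp add: isCont_def filterlim_at_split)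
      then show ?thesis unfolding real ereal_tendsto_simps by (simp add: D_def real)
    next
      case PInf
      have "(?H \<longlongrightarrow> - 0 / \<delta>) at_top"
        using exp_neg_tendsto_0[OF assms(1)] assms(1) by (intro tendsto_intros) auto
      then show ?thesis unfolding PInf ereal_tendsto_simps by (simp add: D_def PInf)
    qed (use less in simp)
    note FTC = interval_integral_FTC_nonneg[OF less der _ _ A B]
    have "set_integrable lborel (einterval (ereal t) T) (\<lambda>s. exp (- \<delta> * (s - t)))"
      by (rule FTC(1)) auto
    moreover have "(LBINT s=ereal t..T. exp (- \<delta> * (s - t))) = - D / \<delta> - - 1 / \<delta>"
      by (rule FTC(2)) auto
    ultimately show ?thesis by (simp add: diff_divide_distrib)
  qed
  then show "set_integrable lborel (einterval (ereal t) T) (\<lambda>s. exp (- \<delta> * (s - t)))"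
    "(LBINT s=ereal t..T. exp (- \<delta> * (s - t))) = (1 - D) / \<delta>" by auto
qed

text \<open>A process controlled by some \<open>k\<close> that pays the maximal rate \<open>L\<close> from time \<open>t + h\<close> on. The case
  \<open>h = 0\<close> covers the constant control.\<close>

locale controlled_ruin = continuous_adapted M F W t Y
  for M :: "'a measure" and F :: "real \<Rightarrow> 'a measure" and W :: "real \<Rightarrow> 'a \<Rightarrow> real"
    and t :: real and Y :: "real \<Rightarrow> 'a \<Rightarrow> real" +
  fixes x \<mu> \<sigma> L h :: real and k :: control
  assumes x_nonneg: "0 \<le> x" and L_pos: "0 < L" and h_nonneg: "0 \<le> h"
    and k_admissible: "k \<in> admissible_controls L"
    and k_maximal: "\<And>s y. t + h \<le> s \<Longrightarrow> k s y = L"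
    and controlled: "controlled_process M F W \<mu> \<sigma> k t x Y"
begin

text \<open>The part of the maximal dividend rate \<open>L\<close> that \<open>k\<close> leaves unused before ruin.\<close>

definition slack :: "'a \<Rightarrow> real \<Rightarrow> real" where
  "slack \<omega> s = (if t < s \<and> ereal s < \<tau> \<omega> then L - k s (Y s \<omega>) else 0)"

lemma slack_bounds: "0 \<le> slack \<omega> s" "slack \<omega> s \<le> L"
proof -
  have "0 \<le> k s (Y s \<omega>) \<and> k s (Y s \<omega>) \<le> L" if "t < s" "ereal s < \<tau> \<omega>"
    using k_admissible positive_before_ruin[of s \<omega>] that t_nonneg
    unfolding admissible_controls_def by (simp add: less_imp_le)
  then show "0 \<le> slack \<omega> s" "slack \<omega> s \<le> L" using L_pos by (auto simp: slack_def)
qed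

lemma slack_support: "slack \<omega> s \<noteq> 0 \<Longrightarrow> t < s \<and> s < t + h \<and> ereal s < \<tau> \<omega>"
  using k_maximal[of s "Y s \<omega>"] by (cases "t + h \<le> s") (auto simp: slack_def split: if_splits)

text \<open>The control is extended by 0 outside the quadrant and the path is frozen before time \<open>t\<close>; neither
  matters between \<open>t\<close> and ruin.\<close>

lemma slack_jointly_measurable:
  "(\<lambda>(\<omega>, s). slack \<omega> s) \<in> borel_measurable (M \<Otimes>\<^sub>M lborel)"
proof -
  let ?k = "\<lambda>p::real \<times> real. indicator ({0..} \<times> {0..}) p *\<^sub>R (case p of (s, y) \<Rightarrow> k s y)"
  have sq: "({0..} \<times> {0..}) \<inter> space borel \<in> sets (borel :: (real \<times> real) measure)"
    by (intro sets.Int borel_closed closed_Times) auto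
  have [measurable]: "?k \<in> borel_measurable borel"
    using k_admissible unfolding admissible_controls_def borel_measurable_restrict_space_iff[OF sq] by simp
  have [measurable]: "(\<lambda>z. Y (max t (snd z)) (fst z)) \<in> borel_measurable (M \<Otimes>\<^sub>M lborel)"
    by (rule continuous_process_measurable[OF t_nonneg Y_continuous Y_measurable]) simp_all
  have [measurable]: "\<tau> \<in> borel_measurable M" by (rule ruin_time_measurable)
  have "(\<lambda>z. if t < snd z \<and> ereal (snd z) < \<tau> (fst z) then L - ?k (snd z, Y (max t (snd z)) (fst z)) else 0)
      \<in> borel_measurable (M \<Otimes>\<^sub>M lborel)"
    by measurable
  also have "(\<lambda>z. if t < snd z \<and> ereal (snd z) < \<tau> (fst z) then L - ?k (snd z, Y (max t (snd z)) (fst z)) else 0)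
      = (\<lambda>(\<omega>, s). slack \<omega> s)"
    using t_nonneg positive_before_ruin
    by (auto simp: fun_eq_iff slack_def indicator_def max_def less_imp_le)
  finally show ?thesis .
qed

lemma slack_measurable: "\<omega> \<in> space M \<Longrightarrow> slack \<omega> \<in> borel_measurable lborel"
  using measurable_Pair2[OF slack_jointly_measurable] by simp

lemma indicator_integrable: "integrable lborel (\<lambda>s. indicator {t..t+h} s * L)"
  by (intro integrable_mult_left integrable_real_indicator) (simp_all add: emeasure_lborel_Icc_eq)

lemma slack_weighted_integrable:
  assumes "\<omega> \<in> space M" "f \<in> borel_measurable lborel" "\<And>s. t < s \<Longrightarrow> \<bar>f s\<bar> \<le> 1"
  shows "integrable lborel (\<lambda>s. f s * slack \<omega> s)"
proof (rule Bochner_Integration.integrable_bound)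
  show "integrable lborel (\<lambda>s. indicator {t..t+h} s * L)" by (rule indicator_integrable)
  show "AE s in lborel. norm (f s * slack \<omega> s) \<le> norm (indicator {t..t+h} s * L :: real)"
  proof (rule AE_I2)
    fix s
    show "norm (f s * slack \<omega> s) \<le> norm (indicator {t..t+h} s * L :: real)"
    proof (cases "slack \<omega> s = 0")
      case False
      then have s: "t < s" "s < t + h" using slack_support by blast+
      have "\<bar>f s\<bar> * \<bar>slack \<omega> s\<bar> \<le> 1 * L"
        using assms(3)[OF s(1)] slack_bounds[of \<omega> s] by (intro mult_mono) auto
      then show ?thesis using s L_pos by (simp add: abs_mult)
    qed simp
  qed
qed (use assms slack_measurable in measurable)

text \<open>The undiscounted dividends that \<open>k\<close> forgoes. They remain in the surplus and form its excess over the
  process with drift \<open>\<mu> - L\<close>.\<close>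

definition total_slack :: "'a \<Rightarrow> real" where
  "total_slack \<omega> = (\<integral>s. slack \<omega> s \<partial>lborel)"

lemma total_slack_bounds:
  assumes "\<omega> \<in> space M"
  shows "0 \<le> total_slack \<omega>" "total_slack \<omega> \<le> L * h"
proof -
  show "0 \<le> total_slack \<omega>"
    unfolding total_slack_def using slack_bounds by (intro Bochner_Integration.integral_nonneg) auto
  have "total_slack \<omega> \<le> (\<integral>s. indicator {t..t+h} s * L \<partial>lborel)"
    unfolding total_slack_def
  proof (rule integral_mono)
    show "integrable lborel (slack \<omega>)"
      using slack_weighted_integrable[OF assms, of "\<lambda>_. 1"] by simp
    show "slack \<omega> s \<le> indicator {t..t+h} s * L" for s
      using slack_support[of \<omega> s] slack_bounds[of \<omega> s] L_pos by (cases "slack \<omega> s = 0") auto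
  qed (rule indicator_integrable)
  then show "total_slack \<omega> \<le> L * h" using h_nonneg by (simp add: mult.commute)
qed

lemma excess_eq_slack:
  "AE \<omega> in M. Y t \<omega> = x \<and> (\<forall>s\<ge>t. ereal s \<le> \<tau> \<omega> \<longrightarrow>
     excess (\<mu> - L) \<sigma> W t x Y s \<omega> = (\<integral>u. indicator {t<..<s} u * slack \<omega> u \<partial>lborel))"
proof -
  have "AE \<omega> in M. Y t \<omega> = x \<and> (\<forall>s\<ge>t. ereal s \<le> \<tau> \<omega> \<longrightarrow>
      Y s \<omega> = x + (LBINT u=ereal t..ereal s. \<mu> - k u (Y u \<omega>)) + \<sigma> * (W s \<omega> - W t \<omega>))"
    using controlled unfolding controlled_process_def by blast
  then show ?thesis using AE_space
  proof eventually_elim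
    case (elim \<omega>)
    have "excess (\<mu> - L) \<sigma> W t x Y s \<omega> = (\<integral>u. indicator {t<..<s} u * slack \<omega> u \<partial>lborel)"
      if s: "t \<le> s" "ereal s \<le> \<tau> \<omega>" for s
    proof -
      have int: "integrable lborel (\<lambda>u. indicator {t<..<s} u * slack \<omega> u)"
        using slack_weighted_integrable[OF elim(2), of "indicator {t<..<s}"] by (simp add: indicator_def)
      have "(LBINT u=ereal t..ereal s. \<mu> - k u (Y u \<omega>)) =
          (\<integral>u. indicator {t<..<s} u *\<^sub>R (\<mu> - k u (Y u \<omega>)) \<partial>lborel)"
        using s(1) by (simp add: interval_lebesgue_integral_def set_lebesgue_integral_def)
      also have "\<dots> = (\<integral>u. indicator {t<..<s} u * (\<mu> - L) + indicator {t<..<s} u * slack \<omega> u \<partial>lborel)"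
      proof (rule Bochner_Integration.integral_cong[OF refl])
        fix u
        have "ereal u < \<tau> \<omega>" if "u < s"
          using that s(2) less_le_trans[of "ereal u" "ereal s" "\<tau> \<omega>"] by simp
        then show "indicator {t<..<s} u *\<^sub>R (\<mu> - k u (Y u \<omega>)) =
            indicator {t<..<s} u * (\<mu> - L) + indicator {t<..<s} u * slack \<omega> u"
          by (auto simp: slack_def indicator_def)
      qed
      also have "\<dots> = (\<mu> - L) * (s - t) + (\<integral>u. indicator {t<..<s} u * slack \<omega> u \<partial>lborel)"
        using int s(1) by (subst Bochner_Integration.integral_add) simp_all
      finally show ?thesis using elim(1) s unfolding excess_def by simp
    qed
    then show ?case using elim(1) by blast
  qed
qed

sublocale perturbed_ruin M F W t Y x "\<mu> - L" \<sigma> "t + h" "L * h"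
proof unfold_locales
  show "AE \<omega> in M. Y t \<omega> = x \<and>
      (\<forall>s\<ge>t. ereal s \<le> ruin_time t Y \<omega> \<longrightarrow>
        0 \<le> excess (\<mu> - L) \<sigma> W t x Y s \<omega> \<and> excess (\<mu> - L) \<sigma> W t x Y s \<omega> \<le> L * h) \<and>
      (\<forall>s\<ge>t+h. ereal s \<le> ruin_time t Y \<omega> \<longrightarrow>
        excess (\<mu> - L) \<sigma> W t x Y s \<omega> = excess (\<mu> - L) \<sigma> W t x Y (t + h) \<omega>)"
    using excess_eq_slack AE_space
  proof eventually_elim
    case (elim \<omega>)
    let ?I = "\<lambda>s. \<integral>u. indicator {t<..<s} u * slack \<omega> u \<partial>lborel"
    have I_bounds: "0 \<le> ?I s \<and> ?I s \<le> L * h" for s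
    proof
      show "0 \<le> ?I s"
        using slack_bounds by (intro Bochner_Integration.integral_nonneg) simp
      have "?I s \<le> total_slack \<omega>"
        unfolding total_slack_def
      proof (rule integral_mono)
        show "integrable lborel (\<lambda>u. indicator {t<..<s} u * slack \<omega> u)"
          using slack_weighted_integrable[OF elim(2), of "indicator {t<..<s}"] by (simp add: indicator_def)
        show "integrable lborel (slack \<omega>)"
          using slack_weighted_integrable[OF elim(2), of "\<lambda>_. 1"] by simp
        show "indicator {t<..<s} u * slack \<omega> u \<le> slack \<omega> u" for u
          using slack_bounds[of \<omega> u] by (simp add: indicator_def)
      qed
      then show "?I s \<le> L * h" using total_slack_bounds(2)[OF elim(2)] by simp
    qed
    have I_const: "?I s = ?I (t + h)" if "t + h \<le> s" for s
    proof (rule Bochner_Integration.integral_cong[OF refl])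
      fix u
      show "indicator {t<..<s} u * slack \<omega> u = indicator {t<..<t+h} u * slack \<omega> u"
        using slack_support[of \<omega> u] that by (cases "slack \<omega> u = 0") auto
    qed
    have G: "excess (\<mu> - L) \<sigma> W t x Y s \<omega> = ?I s" if "t \<le> s" "ereal s \<le> \<tau> \<omega>" for s
      using elim(1) that by blast
    show ?case
    proof (intro conjI allI impI)
      show "Y t \<omega> = x" using elim(1) by blast
    next
      fix s assume "t \<le> s" "ereal s \<le> \<tau> \<omega>"
      then show "0 \<le> excess (\<mu> - L) \<sigma> W t x Y s \<omega>" "excess (\<mu> - L) \<sigma> W t x Y s \<omega> \<le> L * h"
        unfolding G[OF \<open>t \<le> s\<close> \<open>ereal s \<le> \<tau> \<omega>\<close>] using I_bounds by blast+
    next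
      fix s assume s: "t + h \<le> s" "ereal s \<le> \<tau> \<omega>"
      have "ereal (t + h) \<le> \<tau> \<omega>" using s order_trans[of "ereal (t + h)" "ereal s"] by simp
      then show "excess (\<mu> - L) \<sigma> W t x Y s \<omega> = excess (\<mu> - L) \<sigma> W t x Y (t + h) \<omega>"
        using G[of s] G[of "t + h"] s h_nonneg I_const[OF s(1)] by simp
    qed
  qed
qed (use x_nonneg h_nonneg L_pos in auto)

lemma total_excess_eq_total_slack: "AE \<omega> in M. total_excess \<omega> = total_slack \<omega>"
  using excess_eq_slack AE_dynamics
proof eventually_elim
  case (elim \<omega>)
  let ?\<rho> = "stopped (t + h) \<omega>"
  have th: "t \<le> t + h" using h_nonneg by simp
  have "total_excess \<omega> = G ?\<rho> \<omega>" using elim(2) by simp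
  also have "\<dots> = (\<integral>u. indicator {t<..<?\<rho>} u * slack \<omega> u \<partial>lborel)"
    using elim(1) stopped_props[OF th] by blast
  also have "\<dots> = total_slack \<omega>"
    unfolding total_slack_def
  proof (rule Bochner_Integration.integral_cong[OF refl])
    fix u
    have "t < u \<and> u < ?\<rho>" if "slack \<omega> u \<noteq> 0"
      using slack_support[OF that] by (cases "\<tau> \<omega>") (auto simp: stopped_def min_def)
    then show "indicator {t<..<?\<rho>} u * slack \<omega> u = slack \<omega> u"
      by (cases "slack \<omega> u = 0") auto
  qed
  finally show ?case .
qed

text \<open>The discounted value of the dividends that \<open>k\<close> forgoes in comparison with the maximal rate.\<close>

definition discounted_slack :: "real \<Rightarrow> 'a \<Rightarrow> real" where
  "discounted_slack \<delta> \<omega> = (\<integral>s. exp (- \<delta> * (s - t)) * slack \<omega> s \<partial>lborel)"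

lemma discounted_slack_measurable: "discounted_slack \<delta> \<in> borel_measurable M"
proof -
  have "(\<lambda>(\<omega>, s). exp (- \<delta> * (s - t)) * slack \<omega> s) \<in> borel_measurable (M \<Otimes>\<^sub>M lborel)"
    using slack_jointly_measurable by (simp add: split_beta')
  then show ?thesis
    unfolding discounted_slack_def by (rule lborel.borel_measurable_lebesgue_integral)
qed

lemma discounted_slack_bounds:
  assumes "\<delta> > 0" "\<omega> \<in> space M"
  shows "exp (- \<delta> * h) * total_slack \<omega> \<le> discounted_slack \<delta> \<omega>" "discounted_slack \<delta> \<omega> \<le> total_slack \<omega>"
proof -
  have i1: "integrable lborel (slack \<omega>)"
    using slack_weighted_integrable[OF assms(2), of "\<lambda>_. 1"] by simp
  have i2: "integrable lborel (\<lambda>s. exp (- \<delta> * (s - t)) * slack \<omega> s)"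
    using assms(1) by (intro slack_weighted_integrable[OF assms(2)]) auto
  have "exp (- \<delta> * h) * slack \<omega> s \<le> exp (- \<delta> * (s - t)) * slack \<omega> s"
    "exp (- \<delta> * (s - t)) * slack \<omega> s \<le> slack \<omega> s" for s
  proof -
    have "exp (- \<delta> * h) \<le> exp (- \<delta> * (s - t)) \<and> exp (- \<delta> * (s - t)) \<le> 1" if "slack \<omega> s \<noteq> 0"
      using slack_support[OF that] assms(1) by simp
    then show "exp (- \<delta> * h) * slack \<omega> s \<le> exp (- \<delta> * (s - t)) * slack \<omega> s"
      "exp (- \<delta> * (s - t)) * slack \<omega> s \<le> slack \<omega> s"
      using slack_bounds(1)[of \<omega> s] by (cases "slack \<omega> s = 0"; auto intro: mult_right_mono mult_left_le_one_le)+
  qed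
  note le = this
  have "exp (- \<delta> * h) * total_slack \<omega> = (\<integral>s. exp (- \<delta> * h) * slack \<omega> s \<partial>lborel)"
    unfolding total_slack_def by simp
  also have "\<dots> \<le> discounted_slack \<delta> \<omega>"
    unfolding discounted_slack_def using i1 i2 le(1) by (intro integral_mono) auto
  finally show "exp (- \<delta> * h) * total_slack \<omega> \<le> discounted_slack \<delta> \<omega>" .
  show "discounted_slack \<delta> \<omega> \<le> total_slack \<omega>"
    unfolding discounted_slack_def total_slack_def using i1 i2 le(2) by (intro integral_mono) auto
qed

lemma discounted_slack_integrable:
  assumes "\<delta> > 0"
  shows "integrable M (discounted_slack \<delta>)"
proof (rule integrable_const_bound[of _ "L * h"])
  show "AE \<omega> in M. norm (discounted_slack \<delta> \<omega>) \<le> L * h"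
  proof (rule AE_I2)
    fix \<omega> assume \<omega>: "\<omega> \<in> space M"
    have "0 \<le> exp (- \<delta> * h) * total_slack \<omega>" using total_slack_bounds[OF \<omega>] by simp
    then have "0 \<le> discounted_slack \<delta> \<omega>" using discounted_slack_bounds(1)[OF assms \<omega>] by (rule order_trans)
    then show "norm (discounted_slack \<delta> \<omega>) \<le> L * h"
      using discounted_slack_bounds[OF assms \<omega>] total_slack_bounds[OF \<omega>] by simp
  qed
qed (rule discounted_slack_measurable)

lemma reward_decomposition:
  assumes "\<delta> > 0" "\<beta> > 0"
  shows "(\<integral>\<omega>. (let T = ruin_time t Y \<omega> in
      (LBINT s=ereal t..T. exp (- \<delta> * (s - t)) * k s (Y s \<omega>)) +
      lam * ((if T = \<infinity> then 0 else exp (- \<beta> * (real_of_ereal T - t))) - \<alpha>)) \<partial>M) =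
    L / \<delta> * (1 - (\<integral>\<omega>. discount \<delta> \<omega> \<partial>M)) + lam * ((\<integral>\<omega>. discount \<beta> \<omega> \<partial>M) - \<alpha>) -
      (\<integral>\<omega>. discounted_slack \<delta> \<omega> \<partial>M)" (is "integral\<^sup>L M ?f = _")
proof -
  have "?f \<omega> = L / \<delta> * (1 - discount \<delta> \<omega>) + lam * (discount \<beta> \<omega> - \<alpha>) - discounted_slack \<delta> \<omega>"
    if \<omega>: "\<omega> \<in> space M" for \<omega>
  proof -
    let ?A = "einterval (ereal t) (\<tau> \<omega>)" and ?e = "\<lambda>s. exp (- \<delta> * (s - t))"
    note ann = discounted_annuity[OF assms(1) ruin_time_ge[of \<omega>]]
    have i1: "integrable lborel (\<lambda>s. indicator ?A s * ?e s)"
      using ann(1) unfolding set_integrable_def by simp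
    have i2: "integrable lborel (\<lambda>s. ?e s * slack \<omega> s)"
      using assms(1) by (intro slack_weighted_integrable[OF \<omega>]) auto
    have "(LBINT s=ereal t..\<tau> \<omega>. ?e s * k s (Y s \<omega>)) = (\<integral>s. indicator ?A s * (?e s * k s (Y s \<omega>)) \<partial>lborel)"
      using ruin_time_ge[of \<omega>] by (simp add: interval_lebesgue_integral_def set_lebesgue_integral_def)
    also have "\<dots> = (\<integral>s. L * (indicator ?A s * ?e s) - ?e s * slack \<omega> s \<partial>lborel)"
      by (rule Bochner_Integration.integral_cong[OF refl])
        (auto simp: slack_def indicator_def einterval_iff algebra_simps)
    also have "\<dots> = L * (\<integral>s. indicator ?A s * ?e s \<partial>lborel) - discounted_slack \<delta> \<omega>"
      using i1 i2 by (simp add: discounted_slack_def)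
    also have "(\<integral>s. indicator ?A s * ?e s \<partial>lborel) = (LBINT s=ereal t..\<tau> \<omega>. ?e s)"
      using ruin_time_ge[of \<omega>] by (simp add: interval_lebesgue_integral_def set_lebesgue_integral_def)
    also have "\<dots> = (1 - discount \<delta> \<omega>) / \<delta>"
      unfolding ann(2) discount_def ..
    finally show ?thesis by (simp add: Let_def discount_def)
  qed
  then have "integral\<^sup>L M ?f =
      (\<integral>\<omega>. L / \<delta> * (1 - discount \<delta> \<omega>) + lam * (discount \<beta> \<omega> - \<alpha>) - discounted_slack \<delta> \<omega> \<partial>M)"
    by (rule Bochner_Integration.integral_cong[OF refl])
  also have "\<dots> = L / \<delta> * (1 - (\<integral>\<omega>. discount \<delta> \<omega> \<partial>M)) + lam * ((\<integral>\<omega>. discount \<beta> \<omega> \<partial>M) - \<alpha>) -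
      (\<integral>\<omega>. discounted_slack \<delta> \<omega> \<partial>M)"
    using discount_integrable[OF assms(1)] discount_integrable[OF assms(2)]
      discounted_slack_integrable[OF assms(1)]
    by (simp add: prob_space right_diff_distrib)
  finally show ?thesis .
qed

lemma expectation_discounted_slack_ge:
  assumes "\<delta> > 0"
  shows "exp (- \<delta> * h) * (\<integral>\<omega>. total_excess \<omega> \<partial>M) \<le> (\<integral>\<omega>. discounted_slack \<delta> \<omega> \<partial>M)"
proof -
  have "(\<integral>\<omega>. exp (- \<delta> * h) * total_excess \<omega> \<partial>M) \<le> (\<integral>\<omega>. discounted_slack \<delta> \<omega> \<partial>M)"
  proof (rule integral_mono_AE)
    show "integrable M (\<lambda>\<omega>. exp (- \<delta> * h) * total_excess \<omega>)" using total_excess_integrable by simp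
    show "AE \<omega> in M. exp (- \<delta> * h) * total_excess \<omega> \<le> discounted_slack \<delta> \<omega>"
      using total_excess_eq_total_slack AE_space
      by eventually_elim (use discounted_slack_bounds(1)[OF assms] in simp)
  qed (rule discounted_slack_integrable[OF assms])
  then show ?thesis by simp
qed

end

context perturbed_ruin
begin

text \<open>Transversality: the two exponential terms are discounted away if ruin does not occur, and they
  cancel at ruin.\<close>

lemma stopped_value_tendsto:
  fixes A B C b d \<delta> \<beta> r :: real
  assumes "\<delta> > 0" "\<beta> > 0" "b \<le> 0" "d \<le> 0"
  defines "v \<equiv> \<lambda>s y. exp (- \<delta> * (s - r)) * A * (1 - exp (b * y)) + exp (- \<beta> * (s - r)) * B * (exp (d * y) - 1) + C"
  shows "((\<lambda>w. \<integral>\<omega>. v (stopped w \<omega>) (Y (stopped w \<omega>) \<omega>) \<partial>M) \<longlongrightarrow> C) at_top"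
proof -
  let ?e = "\<lambda>w. exp (- \<delta> * (w - r)) * \<bar>A\<bar> + exp (- \<beta> * (w - r)) * \<bar>B\<bar>"
  have bound: "\<bar>(\<integral>\<omega>. v (stopped w \<omega>) (Y (stopped w \<omega>) \<omega>) \<partial>M) - C\<bar> \<le> ?e w" if "t \<le> w" for w
  proof -
    have meas: "(\<lambda>\<omega>. v (stopped w \<omega>) (Y (stopped w \<omega>) \<omega>)) \<in> borel_measurable M"
      unfolding v_def using stopped_measurable Y_stopped_measurable[OF that] by measurable
    have ae: "AE \<omega> in M. \<bar>v (stopped w \<omega>) (Y (stopped w \<omega>) \<omega>) - C\<bar> \<le> ?e w"
      using AE_dynamics
    proof eventually_elim
      case (elim \<omega>)
      have y: "0 \<le> Y (stopped w \<omega>) \<omega>" using elim that by blast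
      show ?case
      proof (cases "ereal w \<le> \<tau> \<omega>")
        case True
        then have st: "stopped w \<omega> = w" by (rule stopped_before)
        let ?y = "Y w \<omega>"
        have "\<bar>1 - exp (b * ?y)\<bar> \<le> 1" "\<bar>exp (d * ?y) - 1\<bar> \<le> 1"
          using y assms(3,4) unfolding st by (auto simp: abs_le_iff mult_nonpos_nonneg intro: order_trans[of _ 1])
        then have "\<bar>exp (- \<delta> * (w - r)) * A * (1 - exp (b * ?y))\<bar> \<le> exp (- \<delta> * (w - r)) * \<bar>A\<bar>"
          "\<bar>exp (- \<beta> * (w - r)) * B * (exp (d * ?y) - 1)\<bar> \<le> exp (- \<beta> * (w - r)) * \<bar>B\<bar>"
          unfolding abs_mult abs_exp_cancel by (auto intro!: mult_left_le)
        then show ?thesis unfolding st v_def by linarith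
      next
        case False
        then obtain T where T: "\<tau> \<omega> = ereal T" "T \<le> w"
          using ruin_time_ge[of \<omega>] by (cases "\<tau> \<omega>") auto
        have "Y (stopped w \<omega>) \<omega> = 0" using elim T stopped_after[OF T] by simp
        then show ?thesis by (simp add: v_def)
      qed
    qed
    have int0: "integrable M (\<lambda>\<omega>. v (stopped w \<omega>) (Y (stopped w \<omega>) \<omega>) - C)"
      using ae meas by (intro integrable_const_bound[of _ "?e w"]) auto
    then have int: "integrable M (\<lambda>\<omega>. v (stopped w \<omega>) (Y (stopped w \<omega>) \<omega>))"
      using Bochner_Integration.integrable_add[OF int0, of "\<lambda>_. C"] by simp
    have "\<bar>(\<integral>\<omega>. v (stopped w \<omega>) (Y (stopped w \<omega>) \<omega>) \<partial>M) - C\<bar> =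
        \<bar>\<integral>\<omega>. v (stopped w \<omega>) (Y (stopped w \<omega>) \<omega>) - C \<partial>M\<bar>"
      using int by (simp add: prob_space)
    also have "\<dots> \<le> (\<integral>\<omega>. \<bar>v (stopped w \<omega>) (Y (stopped w \<omega>) \<omega>) - C\<bar> \<partial>M)"
      by (rule integral_abs_bound)
    also have "\<dots> \<le> (\<integral>\<omega>. ?e w \<partial>M)"
      using int0 ae by (intro integral_mono_AE) auto
    finally show ?thesis by (simp add: prob_space)
  qed
  have "(?e \<longlongrightarrow> 0 * \<bar>A\<bar> + 0 * \<bar>B\<bar>) at_top"
    by (intro tendsto_intros exp_neg_tendsto_0 assms)
  then have e0: "(?e \<longlongrightarrow> 0) at_top" by simp
  have "((\<lambda>w. (\<integral>\<omega>. v (stopped w \<omega>) (Y (stopped w \<omega>) \<omega>) \<partial>M) - C) \<longlongrightarrow> 0) at_top"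
    by (rule Lim_null_comparison[OF _ e0])
      (use bound in \<open>auto simp: eventually_at_top_linorder\<close>)
  then show ?thesis by (rule LIM_zero_cancel)
qed

end

context controlled_ruin
begin

text \<open>Deviating for a time \<open>h\<close> trades forgone dividends of mean \<open>D\<close>, discounted by at most \<open>exp (- \<delta> h)\<close>,
  for an increase of the surplus by \<open>D\<close>, which is worth at most the slope \<open>- b L / \<delta> + lam d \<le> 1\<close> at 0.
  The gain is therefore \<open>o(h)\<close>.\<close>

lemma reward_le:
  assumes "\<delta> > 0" "\<beta> > 0" "lam \<le> 0" "b < 0" "d < 0"
    and b: "\<sigma>\<^sup>2 / 2 * b\<^sup>2 + (\<mu> - L) * b = \<delta>" and d: "\<sigma>\<^sup>2 / 2 * d\<^sup>2 + (\<mu> - L) * d = \<beta>"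
    and slope: "- b * (L / \<delta>) + lam * d \<le> 1"
  shows "(\<integral>\<omega>. (let T = ruin_time t Y \<omega> in
      (LBINT s=ereal t..T. exp (- \<delta> * (s - t)) * k s (Y s \<omega>)) +
      lam * ((if T = \<infinity> then 0 else exp (- \<beta> * (real_of_ereal T - t))) - \<alpha>)) \<partial>M) \<le>
    L / \<delta> * (1 - exp (b * x)) + lam * (exp (d * x) - \<alpha>) +
    h * (L * ((1 - exp (- \<delta> * h)) + - b * (L / \<delta>) * sqrt (exp ((b * \<sigma>)\<^sup>2 * h) - 1)
      + lam * d * sqrt (exp ((d * \<sigma>)\<^sup>2 * h) - 1)))" (is "?J \<le> _")
proof -
  define D where "D = (\<integral>\<omega>. total_excess \<omega> \<partial>M)"
  define eb where "eb = sqrt (exp ((b * \<sigma>)\<^sup>2 * h) - 1)"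
  define ed where "ed = sqrt (exp ((d * \<sigma>)\<^sup>2 * h) - 1)"
  define K where "K = L * h"
  define p where "p = - b * (L / \<delta>)"
  define q where "q = lam * d"
  have e0: "0 \<le> eb" "0 \<le> ed" using h_nonneg by (auto simp: eb_def ed_def)
  have pq: "0 \<le> p" "0 \<le> q"
    unfolding p_def q_def using assms(1,3,4,5) L_pos
    by (intro mult_nonneg_nonneg divide_nonneg_pos mult_nonpos_nonpos; simp)+
  have D: "0 \<le> D" "D \<le> K"
  proof -
    show "0 \<le> D" unfolding D_def using total_excess_bounds by (intro Bochner_Integration.integral_nonneg) auto
    have "D \<le> (\<integral>\<omega>. L * h \<partial>M)"
      unfolding D_def using total_excess_bounds total_excess_integrable by (intro integral_mono) auto
    then show "D \<le> K" by (simp add: K_def prob_space)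
  qed
  have K0: "0 \<le> K" using D by simp
  have Eb: "exp (b * x) * (1 + b * D + b * (K * eb)) \<le> (\<integral>\<omega>. discount \<delta> \<omega> \<partial>M)"
    using expectation_discount_ge[OF assms(1,4) b] by (simp add: D_def eb_def K_def)
  have Ed: "exp (d * x) * (1 + d * D + d * (K * ed)) \<le> (\<integral>\<omega>. discount \<beta> \<omega> \<partial>M)"
    using expectation_discount_ge[OF assms(2,5) d] by (simp add: D_def ed_def K_def)
  have "?J = L / \<delta> * (1 - (\<integral>\<omega>. discount \<delta> \<omega> \<partial>M)) + lam * ((\<integral>\<omega>. discount \<beta> \<omega> \<partial>M) - \<alpha>) -
      (\<integral>\<omega>. discounted_slack \<delta> \<omega> \<partial>M)"
    by (rule reward_decomposition[OF assms(1,2)])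
  also have "\<dots> \<le> L / \<delta> * (1 - exp (b * x) * (1 + b * D + b * (K * eb))) +
      lam * (exp (d * x) * (1 + d * D + d * (K * ed)) - \<alpha>) - exp (- \<delta> * h) * D"
    using Eb Ed expectation_discounted_slack_ge[OF assms(1)] assms(1,3) L_pos
    by (intro diff_mono add_mono mult_left_mono mult_left_mono_neg) (auto simp: D_def)
  also have "\<dots> = L / \<delta> * (1 - exp (b * x)) + lam * (exp (d * x) - \<alpha>) +
      (exp (b * x) * (p * (D + K * eb)) + exp (d * x) * (q * (D + K * ed)) - exp (- \<delta> * h) * D)"
    by (simp add: p_def q_def algebra_simps add_divide_distrib)
  also have "\<dots> \<le> L / \<delta> * (1 - exp (b * x)) + lam * (exp (d * x) - \<alpha>) +
      K * ((1 - exp (- \<delta> * h)) + p * eb + q * ed)"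
  proof (intro add_left_mono)
    have "exp (b * x) * (p * (D + K * eb)) \<le> 1 * (p * (D + K * eb))"
      using pq e0 D K0 x_nonneg assms(4) by (intro mult_right_mono) (auto simp: mult_nonpos_nonneg)
    moreover have "exp (d * x) * (q * (D + K * ed)) \<le> 1 * (q * (D + K * ed))"
      using pq e0 D K0 x_nonneg assms(5) by (intro mult_right_mono) (auto simp: mult_nonpos_nonneg)
    moreover have "(p + q) * D \<le> 1 * D"
      using slope D by (intro mult_right_mono) (auto simp: p_def q_def)
    moreover have "(1 - exp (- \<delta> * h)) * D \<le> (1 - exp (- \<delta> * h)) * K"
      using D assms(1) h_nonneg by (intro mult_left_mono) auto
    ultimately show "exp (b * x) * (p * (D + K * eb)) + exp (d * x) * (q * (D + K * ed)) - exp (- \<delta> * h) * D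
        \<le> K * ((1 - exp (- \<delta> * h)) + p * eb + q * ed)"
      by (simp add: algebra_simps)
  qed
  also have "K * ((1 - exp (- \<delta> * h)) + p * eb + q * ed) =
      h * (L * ((1 - exp (- \<delta> * h)) + p * eb + q * ed))"
    by (simp add: K_def)
  finally show ?thesis unfolding p_def q_def eb_def ed_def .
qed

lemma reward_maximal:
  assumes "h = 0" "\<delta> > 0" "\<beta> > 0" "b < 0" "d < 0"
    and b: "\<sigma>\<^sup>2 / 2 * b\<^sup>2 + (\<mu> - L) * b = \<delta>" and d: "\<sigma>\<^sup>2 / 2 * d\<^sup>2 + (\<mu> - L) * d = \<beta>"
  shows "(\<integral>\<omega>. (let T = ruin_time t Y \<omega> in
      (LBINT s=ereal t..T. exp (- \<delta> * (s - t)) * k s (Y s \<omega>)) +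
      lam * ((if T = \<infinity> then 0 else exp (- \<beta> * (real_of_ereal T - t))) - \<alpha>)) \<partial>M) =
    L / \<delta> * (1 - exp (b * x)) + lam * (exp (d * x) - \<alpha>)"
proof -
  have "total_excess \<omega> = 0" for \<omega> using total_excess_bounds[of \<omega>] assms(1) by simp
  then have "(\<integral>\<omega>. discount \<delta> \<omega> \<partial>M) = exp (b * x)" "(\<integral>\<omega>. discount \<beta> \<omega> \<partial>M) = exp (d * x)"
    using expectation_discount_compensated[OF assms(2,4) b]
      expectation_discount_compensated[OF assms(3,5) d] by simp_all
  moreover have "slack \<omega> s = 0" for \<omega> s using slack_support[of \<omega> s] assms(1) by fastforce
  then have "discounted_slack \<delta> \<omega> = 0" for \<omega> by (simp add: discounted_slack_def)
  ultimately show ?thesis using reward_decomposition[OF assms(2,3)] by simp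
qed

end

lemma controlled_ruinI:
  assumes "standard_brownian_motion M F W" "0 \<le> t" "0 \<le> x" "0 < L" "0 \<le> h"
    and "k \<in> admissible_controls L" "\<And>s y. t + h \<le> s \<Longrightarrow> k s y = L"
    and c: "controlled_process M F W \<mu> \<sigma> k t x Y"
  shows "controlled_ruin M F W t Y x \<mu> \<sigma> L h k"
proof -
  interpret prob_space M using assms(1) unfolding standard_brownian_motion_def by blast
  show ?thesis
  proof unfold_locales
    show "Y s \<in> borel_measurable (F s)" if "t \<le> s" for s
      using c that unfolding controlled_process_def by blast
    show "continuous_on {t..} (\<lambda>s. Y s \<omega>)" if "\<omega> \<in> space M" for \<omega>
      using c that unfolding controlled_process_def by blast
  qed (use assms in auto)
qed

lemma perturbed_control_admissible:
  assumes "l \<in> admissible_controls L" "l' \<in> admissible_controls L"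
  shows "perturbed_control l l' t h \<in> admissible_controls L"
proof -
  let ?N = "restrict_space borel ({0..} \<times> {0..}) :: (real \<times> real) measure"
  have m: "(\<lambda>(s, y). l s y) \<in> borel_measurable ?N" "(\<lambda>(s, y). l' s y) \<in> borel_measurable ?N"
    using assms unfolding admissible_controls_def by auto
  have [measurable]: "fst \<in> borel_measurable ?N"
    by (rule measurable_restrict_space1) (auto intro!: borel_measurable_continuous_onI continuous_intros)
  have "(\<lambda>p. if t \<le> fst p \<and> fst p < t + h then (\<lambda>(s, y). l s y) p else (\<lambda>(s, y). l' s y) p) \<in> borel_measurable ?N"
    using m by measurable
  moreover have "(\<lambda>p. if t \<le> fst p \<and> fst p < t + h then (\<lambda>(s, y). l s y) p else (\<lambda>(s, y). l' s y) p)
      = (\<lambda>(s, y). perturbed_control l l' t h s y)"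
    by (auto simp: perturbed_control_def fun_eq_iff)
  ultimately show ?thesis
    using assms unfolding admissible_controls_def by (auto simp: perturbed_control_def)
qed

lemma constant_control_admissible: "0 \<le> L \<Longrightarrow> (\<lambda>_ _. L) \<in> admissible_controls L"
  by (simp add: admissible_controls_def)

lemma negative_characteristic_root:
  fixes m \<sigma> q :: real
  assumes "\<sigma> > 0" "q > 0" and b: "b = - m / \<sigma>\<^sup>2 - sqrt (m\<^sup>2 / \<sigma> ^ 4 + 2 * q / \<sigma>\<^sup>2)"
  shows "b < 0" and "\<sigma>\<^sup>2 / 2 * b\<^sup>2 + m * b = q"
proof -
  define p where "p = m / \<sigma>\<^sup>2"
  define s where "s = sqrt (m\<^sup>2 / \<sigma> ^ 4 + 2 * q / \<sigma>\<^sup>2)"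
  have m: "m = \<sigma>\<^sup>2 * p" using assms(1) by (simp add: p_def)
  have "m\<^sup>2 / \<sigma> ^ 4 = p\<^sup>2" unfolding p_def by (simp add: power_divide flip: power_mult)
  then have s_eq: "s = sqrt (p\<^sup>2 + 2 * q / \<sigma>\<^sup>2)" by (simp add: s_def)
  have pos: "0 < 2 * q / \<sigma>\<^sup>2" using assms(1,2) by simp
  have "\<bar>p\<bar> < s" unfolding s_eq using pos by (intro real_less_rsqrt) simp
  have bps: "b = - p - s" using b by (simp add: p_def s_def)
  show "b < 0" using \<open>\<bar>p\<bar> < s\<close> bps by linarith
  have "s\<^sup>2 = p\<^sup>2 + 2 * q / \<sigma>\<^sup>2" unfolding s_eq using pos by (intro real_sqrt_pow2) (simp add: add_nonneg_pos less_imp_le)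
  then have s2: "\<sigma>\<^sup>2 * s\<^sup>2 = \<sigma>\<^sup>2 * p\<^sup>2 + 2 * q" using assms(1) by (simp add: distrib_left)
  have "\<sigma>\<^sup>2 / 2 * b\<^sup>2 + m * b = (\<sigma>\<^sup>2 * s\<^sup>2 - \<sigma>\<^sup>2 * p\<^sup>2) / 2"
    unfolding bps m by (simp add: power2_eq_square field_simps)
  then show "\<sigma>\<^sup>2 / 2 * b\<^sup>2 + m * b = q" using s2 by simp
qed

section \<open>Derivatives of the candidate value function\<close>

lemma at_within_Ici_neq_bot: "0 \<le> (x::real) \<Longrightarrow> at x within {0..} \<noteq> bot"
proof -
  assume "0 \<le> x"
  then have "at_right x \<le> at x within {0..}" by (intro at_le) auto
  then show ?thesis using trivial_limit_at_right_real[of x] by (metis bot.extremum_uniqueI)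
qed

text \<open>Derivatives within \<open>[0, \<infinity>)\<close> depend only on values there. This matters for second derivatives, since
  the first derivative is specified on \<open>[0, \<infinity>)\<close> only.\<close>

lemma vector_derivative_Ici:
  fixes f :: "real \<Rightarrow> real"
  assumes "0 \<le> x" "(f has_real_derivative D) (at x)" "\<And>y. 0 \<le> y \<Longrightarrow> g y = f y"
  shows "vector_derivative g (at x within {0..}) = D" "g differentiable (at x within {0..})"
proof -
  have "(f has_vector_derivative D) (at x within {0..})"
    using assms(2) unfolding has_real_derivative_iff_has_vector_derivative
    by (rule has_vector_derivative_at_within)
  then have g: "(g has_vector_derivative D) (at x within {0..})"
    by (rule has_vector_derivative_transform[of x "{0..}" g f, rotated 2]) (simp_all add: assms(1,3))
  then show "vector_derivative g (at x within {0..}) = D"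
    by (intro vector_derivative_within at_within_Ici_neq_bot assms(1))
  show "g differentiable (at x within {0..})"
    using g by (rule differentiableI_vector)
qed

text \<open>The general form of the candidate value function, for fixed \<open>r\<close>.\<close>

locale two_exponentials =
  fixes \<delta> \<beta> A B C b d r :: real and v :: "real \<Rightarrow> real \<Rightarrow> real"
  assumes v_def: "\<And>t x. v t x = exp (- \<delta> * (t - r)) * A * (1 - exp (b * x)) + exp (- \<beta> * (t - r)) * B * (exp (d * x) - 1) + C"
begin

lemma v_t:
  assumes "0 \<le> t"
  shows "partial_t v t x = - \<delta> * exp (- \<delta> * (t - r)) * A * (1 - exp (b * x)) - \<beta> * exp (- \<beta> * (t - r)) * B * (exp (d * x) - 1)" (is "_ = ?D")
    and "(\<lambda>s. v s x) differentiable (at t within {0..})"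
proof -
  have D: "((\<lambda>s. v s x) has_real_derivative ?D) (at t)"
    unfolding v_def by (auto intro!: derivative_eq_intros simp: algebra_simps)
  show "partial_t v t x = ?D" "(\<lambda>s. v s x) differentiable (at t within {0..})"
    unfolding partial_t_def using vector_derivative_Ici[OF assms D] by auto
qed

lemma v_x:
  assumes "0 \<le> x"
  shows "partial_x v t x = - b * exp (- \<delta> * (t - r)) * A * exp (b * x) + d * exp (- \<beta> * (t - r)) * B * exp (d * x)" (is "_ = ?D")
    and "v t differentiable (at x within {0..})"
proof -
  have D: "(v t has_real_derivative ?D) (at x)"
    unfolding v_def by (auto intro!: derivative_eq_intros simp: algebra_simps)
  show "partial_x v t x = ?D" "v t differentiable (at x within {0..})"
    unfolding partial_x_def using vector_derivative_Ici[OF assms D] by auto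
qed

lemma v_xx:
  assumes "0 \<le> x"
  shows "partial_x (partial_x v) t x = - b\<^sup>2 * exp (- \<delta> * (t - r)) * A * exp (b * x) + d\<^sup>2 * exp (- \<beta> * (t - r)) * B * exp (d * x)" (is "_ = ?D")
    and "partial_x v t differentiable (at x within {0..})"
proof -
  let ?f = "\<lambda>x. - b * exp (- \<delta> * (t - r)) * A * exp (b * x) + d * exp (- \<beta> * (t - r)) * B * exp (d * x)"
  have D: "(?f has_real_derivative ?D) (at x)"
    by (auto intro!: derivative_eq_intros simp: algebra_simps power2_eq_square)
  show "partial_x (partial_x v) t x = ?D" "partial_x v t differentiable (at x within {0..})"
    unfolding partial_x_def[of "partial_x v"] using vector_derivative_Ici[OF assms D v_x(1)] by auto
qed

lemma v_C12: "C12_quadrant v"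
proof -
  let ?Q = "{0::real..} \<times> {0::real..}"
  have "continuous_on ?Q (\<lambda>(t, x). v t x)"
    unfolding v_def split_beta by (intro continuous_intros)
  moreover have "continuous_on ?Q (\<lambda>(t, x). partial_t v t x)"
    by (rule continuous_on_eq[where f = "\<lambda>(t, x). - \<delta> * exp (- \<delta> * (t - r)) * A * (1 - exp (b * x)) - \<beta> * exp (- \<beta> * (t - r)) * B * (exp (d * x) - 1)"])
      (auto simp: v_t split_beta intro!: continuous_intros)
  moreover have "continuous_on ?Q (\<lambda>(t, x). partial_x v t x)"
    by (rule continuous_on_eq[where f = "\<lambda>(t, x). - b * exp (- \<delta> * (t - r)) * A * exp (b * x) + d * exp (- \<beta> * (t - r)) * B * exp (d * x)"])
      (auto simp: v_x split_beta intro!: continuous_intros)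
  moreover have "continuous_on ?Q (\<lambda>(t, x). partial_x (partial_x v) t x)"
    by (rule continuous_on_eq[where f = "\<lambda>(t, x). - b\<^sup>2 * exp (- \<delta> * (t - r)) * A * exp (b * x) + d\<^sup>2 * exp (- \<beta> * (t - r)) * B * exp (d * x)"])
      (auto simp: v_xx split_beta intro!: continuous_intros)
  ultimately show ?thesis
    unfolding C12_quadrant_def using v_t(2) v_x(2) v_xx(2) by auto
qed

lemma v_generator:
  assumes "0 \<le> t" "0 \<le> x" and b: "\<sigma>\<^sup>2 / 2 * b\<^sup>2 + m * b = \<delta>" and d: "\<sigma>\<^sup>2 / 2 * d\<^sup>2 + m * d = \<beta>"
  shows "partial_t v t x + m * partial_x v t x + \<sigma>\<^sup>2 / 2 * partial_x (partial_x v) t x =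
    - \<delta> * A * exp (- \<delta> * (t - r)) + \<beta> * B * exp (- \<beta> * (t - r))"
proof -
  let ?e = "exp (- \<delta> * (t - r))" and ?f = "exp (- \<beta> * (t - r))"
  have "partial_t v t x + m * partial_x v t x + \<sigma>\<^sup>2 / 2 * partial_x (partial_x v) t x =
      - \<delta> * A * ?e + \<beta> * B * ?f
      + ?e * A * exp (b * x) * (\<delta> - (\<sigma>\<^sup>2 / 2 * b\<^sup>2 + m * b))
      + ?f * B * exp (d * x) * ((\<sigma>\<^sup>2 / 2 * d\<^sup>2 + m * d) - \<beta>)"
    unfolding v_t(1)[OF assms(1)] v_x(1)[OF assms(2)] v_xx(1)[OF assms(2)] by (simp add: algebra_simps)
  then show ?thesis unfolding b d by simp
qed

end

section \<open>The equilibrium\<close>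

lemma nonneg_Liminf_at_right:
  fixes q \<eta> :: "real \<Rightarrow> real"
  assumes "\<And>h. h > 0 \<Longrightarrow> - \<eta> h \<le> q h" "(\<eta> \<longlongrightarrow> 0) (at_right 0)"
  shows "0 \<le> Liminf (at_right 0) (\<lambda>h. ereal (q h))"
proof -
  have "((\<lambda>h. ereal (- \<eta> h)) \<longlongrightarrow> ereal (- 0)) (at_right 0)"
    using assms(2) by (intro tendsto_intros)
  then have "Liminf (at_right 0) (\<lambda>h. ereal (- \<eta> h)) = 0"
    by (intro lim_imp_Liminf) (auto simp: zero_ereal_def)
  moreover have "Liminf (at_right 0) (\<lambda>h. ereal (- \<eta> h)) \<le> Liminf (at_right 0) (\<lambda>h. ereal (q h))"
    using assms(1) by (intro Liminf_mono) (auto simp: eventually_at_filter)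
  ultimately show ?thesis by simp
qed

theorem proposition1:
  fixes M :: "'a measure" and F :: "real \<Rightarrow> 'a measure" and W :: "real \<Rightarrow> 'a \<Rightarrow> real"
    and X :: "control \<Rightarrow> real \<Rightarrow> real \<Rightarrow> real \<Rightarrow> 'a \<Rightarrow> real"
    and \<mu> \<sigma> \<delta> \<beta> Lmax lam \<alpha> b2 d2 :: real
    and J :: "real \<Rightarrow> real \<Rightarrow> control \<Rightarrow> real"
    and \<nu> :: "real \<Rightarrow> real \<Rightarrow> real \<Rightarrow> real"
    and lhat :: control
  assumes "\<sigma> > 0" and "\<delta> > 0" and "\<beta> > 0" and "Lmax > 0"
    and "lam \<le> 0" and "0 < \<alpha>" and "\<alpha> \<le> 1"
    and "standard_brownian_motion M F W"
    and "\<forall>l\<in>admissible_controls Lmax. \<forall>t\<ge>0. \<forall>x\<ge>0.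
           controlled_process M F W \<mu> \<sigma> l t x (X l t x)"
    and "J = reward M X \<delta> \<beta> lam \<alpha>"
    and "b2 = - (\<mu> - Lmax) / \<sigma>\<^sup>2 - sqrt ((\<mu> - Lmax)\<^sup>2 / \<sigma> ^ 4 + 2 * \<delta> / \<sigma>\<^sup>2)"
    and "d2 = - (\<mu> - Lmax) / \<sigma>\<^sup>2 - sqrt ((\<mu> - Lmax)\<^sup>2 / \<sigma> ^ 4 + 2 * \<beta> / \<sigma>\<^sup>2)"
    and "\<nu> = (\<lambda>r t x. exp (- \<delta> * (t - r)) * (Lmax / \<delta>) * (1 - exp (b2 * x))
                  + exp (- \<beta> * (t - r)) * lam * (exp (d2 * x) - 1) + lam * (1 - \<alpha>))"
    and "lhat = threshold_control Lmax 0"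
    and "- b2 * (Lmax / \<delta>) + lam * d2 - 1 \<le> 0"
  shows "(\<forall>t\<ge>0. \<forall>x\<ge>0. lhat t x = Lmax)
       \<and> equilibrium_control Lmax J lhat
       \<and> extended_HJB M X \<mu> \<sigma> \<delta> \<beta> Lmax lam \<alpha> \<nu> lhat
       \<and> equilibrium_value_function Lmax J lhat (\<lambda>t x. \<nu> t t x)"
proof -
  note \<sigma> = assms(1) and \<delta> = assms(2) and \<beta> = assms(3) and L = assms(4) and lam = assms(5)
  note bm = assms(8) and X = assms(9) and J = assms(10) and \<nu> = assms(13)
  have slope: "- b2 * (Lmax / \<delta>) + lam * d2 \<le> 1" using assms(15) by simp
  note b2 = negative_characteristic_root[OF \<sigma> \<delta> assms(11)]
  note d2 = negative_characteristic_root[OF \<sigma> \<beta> assms(12)]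
  have lhat: "lhat = (\<lambda>_ _. Lmax)" using assms(14) by (auto simp: threshold_control_def fun_eq_iff)
  have adm: "lhat \<in> admissible_controls Lmax"
    unfolding lhat using L by (intro constant_control_admissible) simp
  have max_ruin: "controlled_ruin M F W t (X lhat t x) x \<mu> \<sigma> Lmax 0 lhat"
    if "0 \<le> t" "0 \<le> x" for t x
    by (rule controlled_ruinI[OF bm that L _ adm]) (use X adm that in \<open>simp_all add: lhat\<close>)
  have reward_lhat: "J t x lhat = \<nu> t t x" if "0 \<le> t" "0 \<le> x" for t x
  proof -
    have "J t x lhat = Lmax / \<delta> * (1 - exp (b2 * x)) + lam * (exp (d2 * x) - \<alpha>)"
      unfolding J reward_def
      by (rule controlled_ruin.reward_maximal[OF max_ruin[OF that] refl \<delta> \<beta> b2(1) d2(1) b2(2) d2(2)])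
    then show ?thesis by (simp add: \<nu> algebra_simps diff_divide_distrib)
  qed
  have equi: "equilibrium_control Lmax J lhat"
    unfolding equilibrium_control_def
  proof (intro conjI adm ballI allI impI)
    fix l t x assume l: "l \<in> admissible_controls Lmax" and tx: "0 \<le> (t::real)" "0 \<le> (x::real)"
    let ?\<eta> = "\<lambda>h. Lmax * ((1 - exp (- \<delta> * h)) + - b2 * (Lmax / \<delta>) * sqrt (exp ((b2 * \<sigma>)\<^sup>2 * h) - 1)
      + lam * d2 * sqrt (exp ((d2 * \<sigma>)\<^sup>2 * h) - 1))"
    show "0 \<le> Liminf (at_right 0)
        (\<lambda>h. ereal ((J t x lhat - J t x (perturbed_control l lhat t h)) / h))"
    proof (rule nonneg_Liminf_at_right)
      fix h :: real assume h: "0 < h"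
      let ?k = "perturbed_control l lhat t h"
      have k: "?k \<in> admissible_controls Lmax" by (rule perturbed_control_admissible[OF l adm])
      have ruin: "controlled_ruin M F W t (X ?k t x) x \<mu> \<sigma> Lmax h ?k"
        by (rule controlled_ruinI[OF bm tx L _ k])
          (use X k tx h in \<open>simp_all add: lhat perturbed_control_def\<close>)
      have "J t x ?k \<le> Lmax / \<delta> * (1 - exp (b2 * x)) + lam * (exp (d2 * x) - \<alpha>) + h * ?\<eta> h"
        unfolding J reward_def
        by (rule controlled_ruin.reward_le[OF ruin \<delta> \<beta> lam b2(1) d2(1) b2(2) d2(2) slope])
      also have "Lmax / \<delta> * (1 - exp (b2 * x)) + lam * (exp (d2 * x) - \<alpha>) = J t x lhat"
        unfolding reward_lhat[OF tx] by (simp add: \<nu> algebra_simps diff_divide_distrib)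
      finally show "- ?\<eta> h \<le> (J t x lhat - J t x ?k) / h"
        unfolding pos_le_divide_eq[OF h] by (simp only: mult.commute[of h] mult_minus_left)
    next
      have "isCont ?\<eta> 0" by (intro continuous_intros)
      then have "(?\<eta> \<longlongrightarrow> ?\<eta> 0) (at_right 0)" by (simp only: isCont_def filterlim_at_split)
      then show "(?\<eta> \<longlongrightarrow> 0) (at_right 0)" by simp
    qed
  qed
  have hjb: "extended_HJB M X \<mu> \<sigma> \<delta> \<beta> Lmax lam \<alpha> \<nu> lhat"
    unfolding extended_HJB_def
  proof (intro conjI adm allI impI)
    have two: "two_exponentials \<delta> \<beta> (Lmax / \<delta>) lam (lam * (1 - \<alpha>)) b2 d2 r (\<nu> r)" for r
      by unfold_locales (simp add: \<nu>)
    show "C12_quadrant (\<nu> r)" for r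
      by (rule two_exponentials.v_C12[OF two])
    have zero: "generator \<mu> \<sigma> (lhat t x) (\<nu> r) t x + running_reward \<delta> \<beta> lam r t (lhat t x) = 0"
      if "0 \<le> t" "0 \<le> x" for r t x
      using two_exponentials.v_generator[OF two that b2(2) d2(2), of r] \<delta>
      by (simp add: generator_def running_reward_def lhat)
    then show "generator \<mu> \<sigma> (lhat t x) (\<nu> r) t x + running_reward \<delta> \<beta> lam r t (lhat t x) = 0"
      if "0 \<le> r" "0 \<le> t" "0 \<le> x" for r t x using that by blast
    fix t x :: real assume tx: "0 \<le> t" "0 \<le> x"
    let ?f = "\<lambda>u. generator \<mu> \<sigma> u (\<nu> t) t x + running_reward \<delta> \<beta> lam t t u"
    \<comment> \<open>Both exponential terms of the slope decrease in \<open>x\<close>, so that the slope is largest at 0.\<close>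
    have "partial_x (\<nu> t) t x \<le> 1"
    proof -
      have "- b2 * (Lmax / \<delta>) * exp (b2 * x) \<le> - b2 * (Lmax / \<delta>) * 1"
        using b2(1) L \<delta> tx by (intro mult_left_mono) (simp_all add: mult_nonpos_nonneg divide_nonpos_pos)
      moreover have "lam * d2 * exp (d2 * x) \<le> lam * d2 * 1"
        using d2(1) lam tx by (intro mult_left_mono) (simp_all add: mult_nonpos_nonneg mult_nonpos_nonpos)
      ultimately show ?thesis
        using slope unfolding two_exponentials.v_x(1)[OF two tx(2)] by (simp add: mult.commute)
    qed
    moreover have "?f u - ?f Lmax = (Lmax - u) * (partial_x (\<nu> t) t x - 1)" for u
      by (simp add: generator_def running_reward_def algebra_simps)
    moreover have f0: "?f Lmax = 0" using zero[OF tx, of t] by (simp add: lhat)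
    ultimately have "?f u \<le> 0" if "u \<in> {0..Lmax}" for u
      using that mult_nonneg_nonpos[of "Lmax - u" "partial_x (\<nu> t) t x - 1"] by simp
    then show sup: "(SUP u\<in>{0..Lmax}. ?f u) = 0"
      using f0 L by (intro cSup_eq_maximum) (auto intro!: image_eqI[of _ _ Lmax])
    show "?f (lhat t x) = (SUP u\<in>{0..Lmax}. ?f u)" unfolding sup using f0 by (simp add: lhat)
  next
    fix r t x :: real assume "0 \<le> r" and tx: "0 \<le> t" "0 \<le> x"
    interpret R: controlled_ruin M F W t "X lhat t x" x \<mu> \<sigma> Lmax 0 lhat by (rule max_ruin[OF tx])
    show "((\<lambda>w. \<integral>\<omega>. (let \<theta> = real_of_ereal (min (ereal w) (ruin_time t (X lhat t x) \<omega>)) in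
        \<nu> r \<theta> (X lhat t x \<theta> \<omega>)) \<partial>M) \<longlongrightarrow> lam * (1 - \<alpha>)) at_top"
      using R.stopped_value_tendsto[OF \<delta> \<beta>, of b2 d2 r "Lmax / \<delta>" lam "lam * (1 - \<alpha>)"] b2(1) d2(1)
      by (simp add: \<nu> Let_def R.stopped_def)
  qed
  show ?thesis
    using equi hjb reward_lhat unfolding equilibrium_value_function_def by (auto simp: lhat)
qed

end
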